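(* Let $w\in S_n$, and fix any term order on monomials in $x_1,\ldots,x_n$ satisfying $x_1<x_2<\cdots<x_n$. For each integer $d$ with $1\le d\le \mathrm{raj}(w)-\mathrm{inv}(w)$, $$\mathbf{x}^{\overline{L}_w(d)}=\min\left\{\mathbf{x}^{\overline{\mathrm{wt}}(C,U)}\ \middle|\ (C,U)\text{ is a marked climbing chain of }w\text{ with }\#U=\ell(C)-d\right\}.$$ Equivalently, $$\mathbf{x}^{L_w(d)}=\max\left\{\mathbf{x}^{\mathrm{wt}(C,U)}\ \middle|\ (C,U)\text{ is a marked climbing chain of }w\text{ with }\#U=\ell(C)-d\right\}.$$ Here min and max are taken with respect to the term order.
   Context: Conventions. Permutations are in one-line notation; $t_{ij}$ is the transposition of $i,j$, and $wt_{ij}$ is $w$ with the values in positions $i$ and $j$ exchanged. $w_0\in S_n$ is the longest permutation, $w_0(k)=n+1-k$. The Bruhat order is the transitive closure of $w\le wt_{ij}$ for $i<j$ with $w(i)<w(j)$; $\lessdot$ denotes its cover relation. $e_1,\dots,e_n$ is the standard basis of $\mathbb{Z}^n$, $|v|=\sum_k v_k$, $\mathbf{x}^v=\prod_k x_k^{v_k}$, and $[n]=\{1,\ldots,n\}$. Climbing chains. A climbing chain of $w\in S_n$ is a sequence $C=(C_1,\ldots,C_m)$ of pairs (links) $C_p=(i_p,j_p)$ with $i_p<j_p$, $i_1\le\cdots\le i_m$, $wt_{i_1j_1}\cdots t_{i_mj_m}=w_0$, and $wt_{i_1j_1}\cdots t_{i_{p-1}j_{p-1}}\lessdot wt_{i_1j_1}\cdots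 t_{i_pj_p}$ for each $p\in[m]$; $\ell(C)=m$. (The only climbing chain of $w_0$ is empty. The links of a chain are distinct, so $C$ is also regarded as a set.) The set of minimal markings is $M(C)=\{C_p\mid i_{p-1}<i_p,\text{ or } i_{p-1}=i_p\text{ and }j_{p-1}<j_p\}$ with $i_0=0$. A marked climbing chain is a pair $(C,U)$ with $M(C)\subseteq U\subseteq C$. Its dual weight $\overline{\mathrm{wt}}(C,U)\in\mathbb{Z}^n$ has $k$th entry the number of links of the form $(k,\star)$ in $U$; its weight has $\mathrm{wt}(C,U)_k=n-k-\overline{\mathrm{wt}}(C,U)_k$. Codes. $\mathrm{invcode}(w)_i=\#\{j>i\mid w(j)<w(i)\}$ and $\mathrm{inv}(w)=|\mathrm{invcode}(w)|$. $\overline{\mathrm{rajcode}}(w)_i$ is the maximal number $m$ of positions in a sequence $i=\alpha_1<\cdots<\alpha_m\le n$ with $w(\alpha_1)<\cdots<w(\alpha_m)$, minus one. $\mathrm{rajcode}(w)_k=n-k-\overline{\mathrm{rajcode}}(w)_k$, and $\mathrm{raj}(w)=|\mathrm{rajcode}(w)|$. One has $\mathrm{rajcode}(w)_k\ge\mathrm{invcode}(w)_k$ for all $k$. The vectors $L_w$. Let $D=\mathrm{raj}(w)-\mathrm{inv}(w)$. Set $L_w(0)=\mathrm{invcode}(w)$; for $1\le i\le D$ let $j\in[n]$ be the largest index with $L_w(i-1)_j<\mathrm{rajcode}(w)_j$ and set $L_w(i)=L_w(i-1)+e_j$. Finally $\overline{L}_w(i)_k=n-k-L_w(i)_k$. 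*)

theory Defs
  imports "HOL-Combinatorics.Permutations" "HOL-Library.Poly_Mapping"
begin

text \<open>
  An element of \<open>S_n\<close> is a function \<open>w :: nat \<Rightarrow> nat\<close> with \<open>w permutes {1..n}\<close>;
  \<open>w \<circ> transpose i j\<close> is \<open>w\<close> with the values in positions \<open>i\<close> and \<open>j\<close> exchanged.
  Vectors in \<open>\<int>\<^sup>n\<close> are functions \<open>nat \<Rightarrow> int\<close> of which only the entries in \<open>{1..n}\<close> matter.
\<close>

definition longest_perm :: "nat \<Rightarrow> nat \<Rightarrow> nat" where
  "longest_perm n k = (if k \<in> {1..n} then n + 1 - k else k)"

subsection \<open>Bruhat order\<close>

definition bruhat_step :: "nat \<Rightarrow> (nat \<Rightarrow> nat) \<Rightarrow> (nat \<Rightarrow> nat) \<Rightarrow> bool" where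
  "bruhat_step n u v \<longleftrightarrow>
     (\<exists>i\<in>{1..n}. \<exists>j\<in>{1..n}. i < j \<and> u i < u j \<and> v = u \<circ> transpose i j)"

definition bruhat_le :: "nat \<Rightarrow> (nat \<Rightarrow> nat) \<Rightarrow> (nat \<Rightarrow> nat) \<Rightarrow> bool" where
  "bruhat_le n = (bruhat_step n)\<^sup>*\<^sup>*"

definition bruhat_cover :: "nat \<Rightarrow> (nat \<Rightarrow> nat) \<Rightarrow> (nat \<Rightarrow> nat) \<Rightarrow> bool" where
  "bruhat_cover n u v \<longleftrightarrow>
     bruhat_le n u v \<and> u \<noteq> v \<and>
     (\<forall>z. bruhat_le n u z \<and> bruhat_le n z v \<longrightarrow> z = u \<or> z = v)"

subsection \<open>Climbing chains\<close>

text \<open>\<open>apply_links w [(i\<^sub>1, j\<^sub>1), \<dots>, (i\<^sub>p, j\<^sub>p)]\<close> is \<open>w t\<^sub>i\<^sub>1\<^sub>j\<^sub>1 \<cdots> t\<^sub>i\<^sub>p\<^sub>j\<^sub>p\<close>.\<close>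

definition apply_links :: "(nat \<Rightarrow> nat) \<Rightarrow> (nat \<times> nat) list \<Rightarrow> (nat \<Rightarrow> nat)" where
  "apply_links w C = foldl (\<lambda>u (i, j). u \<circ> transpose i j) w C"

text \<open>List positions start at \<open>0\<close>, so \<open>C ! p\<close> is the link \<open>C\<^sub>p\<^sub>+\<^sub>1\<close>.\<close>

definition climbing_chain :: "nat \<Rightarrow> (nat \<Rightarrow> nat) \<Rightarrow> (nat \<times> nat) list \<Rightarrow> bool" where
  "climbing_chain n w C \<longleftrightarrow>
     (\<forall>(i, j)\<in>set C. 1 \<le> i \<and> i < j \<and> j \<le> n) \<and>
     sorted (map fst C) \<and>
     apply_links w C = longest_perm n \<and>
     (\<forall>p<length C.
        bruhat_cover n (apply_links w (take p C)) (apply_links w (take (Suc p) C)))"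

text \<open>The disjunct \<open>p = 0\<close> encodes the convention \<open>i\<^sub>0 = 0\<close>.\<close>

definition min_markings :: "(nat \<times> nat) list \<Rightarrow> (nat \<times> nat) set" where
  "min_markings C =
     {C ! p | p. p < length C \<and>
        (p = 0 \<or> fst (C ! (p - 1)) < fst (C ! p) \<or>
         fst (C ! (p - 1)) = fst (C ! p) \<and> snd (C ! (p - 1)) < snd (C ! p))}"

definition marked_climbing_chain ::
  "nat \<Rightarrow> (nat \<Rightarrow> nat) \<Rightarrow> (nat \<times> nat) list \<Rightarrow> (nat \<times> nat) set \<Rightarrow> bool" where
  "marked_climbing_chain n w C U \<longleftrightarrow>
     climbing_chain n w C \<and> min_markings C \<subseteq> U \<and> U \<subseteq> set C"

text \<open>The dual weight of \<open>(C, U)\<close>, and its weight, depend on \<open>C\<close> only through \<open>U\<close>.\<close>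

definition dual_wt :: "(nat \<times> nat) set \<Rightarrow> nat \<Rightarrow> int" where
  "dual_wt U k = int (card {c \<in> U. fst c = k})"

definition wt :: "nat \<Rightarrow> (nat \<times> nat) set \<Rightarrow> nat \<Rightarrow> int" where
  "wt n U k = int n - int k - dual_wt U k"

subsection \<open>Codes\<close>

definition vec_size :: "nat \<Rightarrow> (nat \<Rightarrow> int) \<Rightarrow> int" where
  "vec_size n v = (\<Sum>k\<in>{1..n}. v k)"

definition invcode :: "nat \<Rightarrow> (nat \<Rightarrow> nat) \<Rightarrow> nat \<Rightarrow> int" where
  "invcode n w i = int (card {j \<in> {1..n}. i < j \<and> w j < w i})"

definition inv_stat :: "nat \<Rightarrow> (nat \<Rightarrow> nat) \<Rightarrow> int" where
  "inv_stat n w = vec_size n (invcode n w)"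

definition increasing_from :: "nat \<Rightarrow> (nat \<Rightarrow> nat) \<Rightarrow> nat \<Rightarrow> nat list \<Rightarrow> bool" where
  "increasing_from n w i \<alpha> \<longleftrightarrow>
     \<alpha> \<noteq> [] \<and> hd \<alpha> = i \<and> set \<alpha> \<subseteq> {1..n} \<and>
     sorted_wrt (<) \<alpha> \<and> sorted_wrt (<) (map w \<alpha>)"

definition dual_rajcode :: "nat \<Rightarrow> (nat \<Rightarrow> nat) \<Rightarrow> nat \<Rightarrow> int" where
  "dual_rajcode n w i = int (Max {length \<alpha> | \<alpha>. increasing_from n w i \<alpha>}) - 1"

definition rajcode :: "nat \<Rightarrow> (nat \<Rightarrow> nat) \<Rightarrow> nat \<Rightarrow> int" where
  "rajcode n w k = int n - int k - dual_rajcode n w k"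

definition raj :: "nat \<Rightarrow> (nat \<Rightarrow> nat) \<Rightarrow> int" where
  "raj n w = vec_size n (rajcode n w)"

text \<open>Only the values \<open>Lvec n w i\<close> with \<open>i \<le> raj n w - inv_stat n w\<close> are meaningful: for these the
  set under \<^const>\<open>Max\<close> is nonempty at every step.\<close>

primrec Lvec :: "nat \<Rightarrow> (nat \<Rightarrow> nat) \<Rightarrow> nat \<Rightarrow> nat \<Rightarrow> int" where
  "Lvec n w 0 = invcode n w"
| "Lvec n w (Suc i) =
     (let j = Max {k \<in> {1..n}. Lvec n w i k < rajcode n w k}
      in (Lvec n w i)(j := Lvec n w i j + 1))"

definition dual_Lvec :: "nat \<Rightarrow> (nat \<Rightarrow> nat) \<Rightarrow> nat \<Rightarrow> nat \<Rightarrow> int" where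
  "dual_Lvec n w i k = int n - int k - Lvec n w i k"

subsection \<open>Monomials and term orders\<close>

text \<open>
  A (Laurent) monomial is represented by its exponent vector, so the product of monomials is \<open>+\<close>, the
  monomial \<open>1\<close> is \<open>0\<close>, and \<open>x\<^sub>k\<close> is \<open>Poly_Mapping.single k 1\<close>. Integer exponents are used so that
  \<open>xpow n v\<close> is defined for all \<open>v\<close> in \<open>\<int>\<^sup>n\<close> without truncation; genuine monomials, the only ones
  that a term order compares, are those in \<open>monomials n\<close>.
\<close>

definition xpow :: "nat \<Rightarrow> (nat \<Rightarrow> int) \<Rightarrow> (nat \<Rightarrow>\<^sub>0 int)" where
  "xpow n v = (\<Sum>k\<in>{1..n}. Poly_Mapping.single k (v k))"

definition monomials :: "nat \<Rightarrow> (nat \<Rightarrow>\<^sub>0 int) set" where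
  "monomials n =
     {m. Poly_Mapping.keys m \<subseteq> {1..n} \<and> (\<forall>k. 0 \<le> Poly_Mapping.lookup m k)}"

text \<open>\<open>(a, b) \<in> r\<close> reads \<open>a \<le> b\<close>.\<close>

definition term_order :: "nat \<Rightarrow> (nat \<Rightarrow>\<^sub>0 int) rel \<Rightarrow> bool" where
  "term_order n r \<longleftrightarrow>
     linear_order_on (monomials n) r \<and>
     (\<forall>a\<in>monomials n. (0, a) \<in> r) \<and>
     (\<forall>a\<in>monomials n. \<forall>b\<in>monomials n. \<forall>c\<in>monomials n. (a, b) \<in> r \<longrightarrow> (a + c, b + c) \<in> r)"

definition vars_increasing :: "nat \<Rightarrow> (nat \<Rightarrow>\<^sub>0 int) rel \<Rightarrow> bool" where
  "vars_increasing n r \<longleftrightarrow>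
     (\<forall>i\<in>{1..n}. \<forall>j\<in>{1..n}. i < j \<longrightarrow>
        (Poly_Mapping.single i 1, Poly_Mapping.single j 1) \<in> r)"

definition is_minimum :: "'a rel \<Rightarrow> 'a set \<Rightarrow> 'a \<Rightarrow> bool" where
  "is_minimum r A a \<longleftrightarrow> a \<in> A \<and> (\<forall>b\<in>A. (a, b) \<in> r)"

definition is_maximum :: "'a rel \<Rightarrow> 'a set \<Rightarrow> 'a \<Rightarrow> bool" where
  "is_maximum r A a \<longleftrightarrow> a \<in> A \<and> (\<forall>b\<in>A. (b, a) \<in> r)"

end

(*
  Write asc(a) for the number of b > a with w(b) > w(a) and rk(a) for the dual rajcode, so that
  asc and rk are the duals of invcode and rajcode. Every climbing chain has length sum_a asc(a).
  For all k, at least sum_{a >= k} asc(a) links have first entry >= k (since the tail sums of asc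
  do not drop under swaps (i, j) with i < k), and at least sum_{a >= k} rk(a) of the minimal
  markings have first entry >= k (a potential argument along the chain). The vector L_w(d) is
  staircase shaped: for some p it agrees with invcode before p and with rajcode after p. Hence its
  dual has the least tail sums among the dual weights of the same size, and for x_1 < ... < x_n
  smaller tail sums mean a smaller monomial. The bound is attained by a chain that swaps with the
  next larger value on the levels before p, which spends asc(a) links on level a, and afterwards
  with the rightmost larger value of maximal rank, which spends only rk(a) minimal markings.
*)
theory Submission
  imports Defs
begin

section \<open>Bruhat covers and climbing chains\<close>

text \<open>The cover condition \<open>cov\<close> forbids values between \<open>u i\<close> and
  \<open>u j\<close> at the positions between \<open>i\<close> and \<open>j\<close>. Hence every
  ascent among positions right of \<open>i\<close> survives the swap, and \<open>asc\<close> and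
  \<open>rk\<close> never drop there. Since levels only increase along a chain, what waits on later
  levels can only grow, and this makes tail sums the right quantity to bound. Counting minimal
  markings does not go by plain induction on the chain: whether a link is marked depends on the link
  before it, and the rest of a chain may begin in the middle of a level. The induction therefore
  carries the previous link and an amount \<open>q\<close> still owed on the current level. For
  attainment it suffices that on each level the numbers of minimal markings and of links enclose the
  wanted entry; \<open>U\<close> is then filled up level by level.\<close>

definition swp :: "(nat \<Rightarrow> nat) \<Rightarrow> nat \<Rightarrow> nat \<Rightarrow> nat \<Rightarrow> nat" where
  "swp u i j = u \<circ> transpose i j"

lemma swp_apply: "swp u i j a = (if a = i then u j else if a = j then u i else u a)"
  by (simp add: swp_def transpose_def)

definition asc :: "nat \<Rightarrow> (nat \<Rightarrow> nat) \<Rightarrow> nat \<Rightarrow> nat" where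
  "asc n u a = card {b \<in> {a<..n}. u a < u b}"

definition ascents :: "nat \<Rightarrow> (nat \<Rightarrow> nat) \<Rightarrow> (nat \<times> nat) set" where
  "ascents n u = {(a, b). 1 \<le> a \<and> a < b \<and> b \<le> n \<and> u a < u b}"

definition cov :: "(nat \<Rightarrow> nat) \<Rightarrow> nat \<Rightarrow> nat \<Rightarrow> bool" where
  "cov u i j \<longleftrightarrow> u i < u j \<and> (\<forall>b. i < b \<and> b < j \<longrightarrow> u b < u i \<or> u j < u b)"

lemma finite_ascents: "finite (ascents n u)"
  by (rule finite_subset[of _ "{1..n} \<times> {1..n}"]) (auto simp: ascents_def)

lemma card_ascents: "card (ascents n u) = (\<Sum>a\<in>{1..n}. asc n u a)"
proof -
  have "ascents n u = Sigma {1..n} (\<lambda>a. {b \<in> {a<..n}. u a < u b})"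
    by (auto simp: ascents_def)
  then show ?thesis by (simp add: card_SigmaI asc_def)
qed

text \<open>An involution on the pairs \<open>a < b\<close> that maps the ascents of \<open>swp u i j\<close> into those of \<open>u\<close>,
  missing \<open>(i, j)\<close>, and onto the others if \<open>cov u i j\<close>.\<close>

definition pair_flip :: "nat \<Rightarrow> nat \<Rightarrow> nat \<times> nat \<Rightarrow> nat \<times> nat" where
  "pair_flip i j = (\<lambda>(a, b). if (a = i \<and> b \<le> j) \<or> (b = j \<and> i \<le> a) then (a, b)
     else (transpose i j a, transpose i j b))"

lemma inj_on_pair_flip:
  assumes "i < j"
  shows "inj_on (pair_flip i j) {(a, b). a < b}"
proof (rule inj_on_inverseI)
  fix x assume "x \<in> {(a, b). a < (b :: nat)}"
  then show "pair_flip i j (pair_flip i j x) = x"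
    using assms by (auto simp: pair_flip_def swp_apply transpose_def split: if_splits)
qed

lemma card_ascents_step:
  assumes "1 \<le> i" "i < j" "j \<le> n" "u i < u j"
  shows "card (ascents n (swp u i j)) < card (ascents n u)"
proof -
  let ?v = "swp u i j"
  have "pair_flip i j ` ascents n ?v \<subseteq> ascents n u - {(i, j)}"
  proof
    fix y assume "y \<in> pair_flip i j ` ascents n ?v"
    then obtain a b where ab: "1 \<le> a" "a < b" "b \<le> n" "?v a < ?v b" "y = pair_flip i j (a, b)"
      by (auto simp: ascents_def)
    then show "y \<in> ascents n u - {(i, j)}" using assms
      by (auto simp: pair_flip_def swp_apply transpose_def ascents_def split: if_splits)
  qed
  moreover have "inj_on (pair_flip i j) (ascents n ?v)"
    using inj_on_pair_flip[OF assms(2)] by (rule inj_on_subset) (auto simp: ascents_def)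
  ultimately have "card (ascents n ?v) \<le> card (ascents n u - {(i, j)})"
    using finite_ascents by (metis card_inj_on_le finite_Diff)
  also have "\<dots> < card (ascents n u)"
    using assms finite_ascents by (intro psubset_card_mono) (auto simp: ascents_def)
  finally show ?thesis .
qed

text \<open>A position between \<open>i\<close> and \<open>j\<close> with a value between
  \<open>u i\<close> and \<open>u j\<close> would give ascents \<open>(i, b)\<close> and
  \<open>(b, j)\<close> that the flip fixes but the swap destroys. As \<open>cov\<close> excludes
  them, only \<open>(i, j)\<close> is lost.\<close>

lemma card_ascents_cov:
  assumes "1 \<le> i" "i < j" "j \<le> n" "cov u i j" "inj u"
  shows "card (ascents n u) = Suc (card (ascents n (swp u i j)))"
proof -
  let ?v = "swp u i j"
  have lt: "u i < u j" using assms by (simp add: cov_def)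
  have mid: "u b < u i \<or> u j < u b" if "i < b" "b < j" for b
    using assms(4) that by (simp add: cov_def)
  have "pair_flip i j ` (ascents n u - {(i, j)}) \<subseteq> ascents n ?v"
  proof
    fix y assume "y \<in> pair_flip i j ` (ascents n u - {(i, j)})"
    then obtain a b where ab: "1 \<le> a" "a < b" "b \<le> n" "u a < u b" "(a, b) \<noteq> (i, j)"
      "y = pair_flip i j (a, b)"
      by (auto simp: ascents_def)
    then show "y \<in> ascents n ?v" using assms(1-3) lt mid[of a] mid[of b]
      by (auto simp: pair_flip_def swp_apply transpose_def ascents_def split: if_splits)
  qed
  moreover have "inj_on (pair_flip i j) (ascents n u - {(i, j)})"
    using inj_on_pair_flip[OF assms(2)] by (rule inj_on_subset) (auto simp: ascents_def)
  ultimately have "card (ascents n u - {(i, j)}) \<le> card (ascents n ?v)"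
    using finite_ascents by (metis card_inj_on_le)
  moreover have "(i, j) \<in> ascents n u" using assms lt by (auto simp: ascents_def)
  ultimately show ?thesis
    using card_ascents_step[OF assms(1-3) lt] finite_ascents[of n u] by (simp add: card_Diff_singleton)
qed

text \<open>Makes the ascent count a strict measure of height: a drop by exactly one leaves no room
  for an intermediate element.\<close>

lemma bruhat_le_card_ascents:
  assumes "bruhat_le n u v"
  shows "u = v \<or> card (ascents n v) < card (ascents n u)"
  using assms unfolding bruhat_le_def
proof (induction rule: rtranclp_induct)
  case (step y z)
  then have "card (ascents n z) < card (ascents n y)"
    by (auto simp: bruhat_step_def card_ascents_step[unfolded swp_def])
  then show ?case using step by auto
qed auto

lemma bruhat_step_transpose:
  assumes "1 \<le> i" "i < j" "j \<le> n" "u i < u j"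
  shows "bruhat_le n u (swp u i j)"
proof -
  have "i \<in> {1..n}" "j \<in> {1..n}" using assms by auto
  then have "bruhat_step n u (swp u i j)"
    using assms unfolding bruhat_step_def swp_def by blast
  then show ?thesis unfolding bruhat_le_def by (rule r_into_rtranclp[of "bruhat_step n"])
qed

lemma bruhat_cover_iff_cov:
  assumes "u permutes {1..n}" "1 \<le> i" "i < j" "j \<le> n"
  shows "bruhat_cover n u (swp u i j) \<longleftrightarrow> cov u i j"
proof
  let ?v = "swp u i j"
  assume c: "bruhat_cover n u ?v"
  have inj: "inj u" using assms(1) by (rule permutes_inj)
  have less: "card (ascents n ?v) < card (ascents n u)"
    using c bruhat_le_card_ascents by (auto simp: bruhat_cover_def)
  have lt: "u i < u j"
  proof (rule ccontr)
    assume "\<not> u i < u j"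
    then have "u j < u i" using inj assms(3) by (metis injD less_irrefl linorder_neqE_nat)
    then have "card (ascents n (swp ?v i j)) < card (ascents n ?v)"
      using assms by (intro card_ascents_step) (auto simp: swp_apply)
    then show False using less by (simp add: swp_def comp_assoc)
  qed
  have "\<not> (u i < u b \<and> u b < u j)" if b: "i < b" "b < j" for b
  proof
    assume ub: "u i < u b \<and> u b < u j"
    \<comment> \<open>The transposition of \<open>i\<close> and \<open>j\<close> is the product of
      the swaps (i b), (b j), (i b); with an intermediate value at \<open>b\<close> each of the
      three goes up in Bruhat order.\<close>
    define x where "x = swp u i b"
    define y where "y = swp x b j"
    have xu: "bruhat_le n u x"
      unfolding x_def using assms b ub by (intro bruhat_step_transpose) auto
    have xy: "bruhat_le n x y"
      unfolding y_def using assms b ub by (intro bruhat_step_transpose) (auto simp: x_def swp_apply transpose_def)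
    have eq: "?v = swp y i b"
      using b assms(3) by (auto simp: y_def x_def swp_apply transpose_def fun_eq_iff)
    have yv: "bruhat_le n y ?v"
      unfolding eq using assms b ub
      by (intro bruhat_step_transpose) (auto simp: y_def x_def swp_apply transpose_def)
    have "bruhat_le n x ?v" using xy yv unfolding bruhat_le_def by auto
    moreover have "card (ascents n x) < card (ascents n u)"
      unfolding x_def using assms b ub by (intro card_ascents_step) auto
    moreover have "card (ascents n y) < card (ascents n x)"
      unfolding y_def using assms b ub by (intro card_ascents_step) (auto simp: x_def swp_apply transpose_def)
    moreover have "card (ascents n ?v) \<le> card (ascents n y)"
      using bruhat_le_card_ascents[OF yv] by auto
    ultimately show False using c xu unfolding bruhat_cover_def by fastforce
  qed
  moreover have "u b \<noteq> u i" "u b \<noteq> u j" if "i < b" "b < j" for b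
    using that inj by (metis injD less_irrefl)+
  ultimately show "cov u i j" using lt unfolding cov_def by (meson linorder_neqE_nat)
next
  let ?v = "swp u i j"
  assume c: "cov u i j"
  then have lt: "u i < u j" by (simp add: cov_def)
  have inj: "inj u" using assms(1) by (rule permutes_inj)
  have one: "card (ascents n u) = Suc (card (ascents n ?v))"
    using card_ascents_cov[OF assms(2-4) c inj] .
  show "bruhat_cover n u ?v"
    unfolding bruhat_cover_def
  proof (intro conjI allI impI)
    show "bruhat_le n u ?v" using bruhat_step_transpose[OF assms(2-4) lt] .
    show "u \<noteq> ?v" using one by auto
    fix z assume "bruhat_le n u z \<and> bruhat_le n z ?v"
    then show "z = u \<or> z = ?v"
      using bruhat_le_card_ascents[of n u z] bruhat_le_card_ascents[of n z ?v] one by auto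
  qed
qed

text \<open>Covers are replaced by the local \<open>cov\<close>, and sortedness by a bound on all
  later levels, so that the rest of a chain is again an instance for the swapped
  permutation.\<close>

fun climbs :: "nat \<Rightarrow> (nat \<Rightarrow> nat) \<Rightarrow> (nat \<times> nat) list \<Rightarrow> bool" where
  "climbs n u [] \<longleftrightarrow> u = longest_perm n"
| "climbs n u ((i, j) # C) \<longleftrightarrow> 1 \<le> i \<and> i < j \<and> j \<le> n \<and> cov u i j \<and> (\<forall>c\<in>set C. i \<le> fst c) \<and>
     climbs n (swp u i j) C"

lemma permutes_comp_transpose:
  assumes "u permutes {1..n}" "1 \<le> i" "i < j" "j \<le> n"
  shows "swp u i j permutes {1..n}"
  unfolding swp_def
  using assms(2-4) by (intro permutes_compose[OF permutes_swap_id assms(1)]) auto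

lemma climbing_chain_iff_climbs:
  assumes "u permutes {1..n}"
  shows "climbing_chain n u C \<longleftrightarrow> climbs n u C"
  using assms
proof (induction C arbitrary: u)
  case Nil
  then show ?case by (simp add: climbing_chain_def apply_links_def)
next
  case (Cons c C)
  obtain i j where c: "c = (i, j)" by fastforce
  show ?case
  proof (cases "1 \<le> i \<and> i < j \<and> j \<le> n")
    case True
    have "climbing_chain n u (c # C) \<longleftrightarrow> bruhat_cover n u (swp u i j) \<and>
        (\<forall>c\<in>set C. i \<le> fst c) \<and> climbing_chain n (swp u i j) C"
      using True by (auto simp: climbing_chain_def apply_links_def c All_less_Suc2 swp_def)
    then show ?thesis
      using True Cons.IH[OF permutes_comp_transpose[OF Cons.prems]]
        bruhat_cover_iff_cov[OF Cons.prems, of i j] c by auto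
  qed (auto simp: climbing_chain_def c)
qed

text \<open>Every link removes exactly one ascent and the longest permutation has none; so the
  condition on the size of \<open>U\<close> prescribes the same number for all chains.\<close>

lemma climbs_length:
  assumes "climbs n u C" "u permutes {1..n}"
  shows "length C = card (ascents n u)"
  using assms
proof (induction n u C rule: climbs.induct)
  case (1 n u)
  then have "ascents n u = {}" by (auto simp: ascents_def longest_perm_def)
  then show ?case by simp
next
  case (2 n u i j C)
  have "length C = card (ascents n (swp u i j))"
    using 2(2,3) by (intro 2(1) permutes_comp_transpose) auto
  then show ?case
    using 2(2) card_ascents_cov[of i j n u] permutes_inj[OF 2(3)] by simp
qed

text \<open>While level \<open>i\<close> lasts, the value at \<open>i\<close> only grows and the
  smaller value at \<open>j\<close> stays put, so \<open>j\<close> never becomes a legal partner.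
  Right after the link \<open>(i, j)\<close> this is the situation, whence chains have no repeated
  links.\<close>

lemma climbs_no_return:
  assumes "climbs n u C" "\<forall>c\<in>set C. i \<le> fst c" "u j < u i" "i < j"
  shows "(i, j) \<notin> set C"
  using assms
proof (induction n u C rule: climbs.induct)
  case (2 n u i' j' C)
  show ?case
  proof (cases "i' = i")
    case True
    then have "u i < u j'" using 2(2) by (simp add: cov_def)
    then have "j' \<noteq> j" using 2(4) by auto
    moreover have "(i, j) \<notin> set C"
      using 2(2-) True \<open>u i < u j'\<close> \<open>j' \<noteq> j\<close>
      by (intro 2(1)) (auto simp: swp_apply[of u i j' i] swp_apply[of u i j' j])
    ultimately show ?thesis by auto
  next
    case False
    then have "i < i'" using 2 by auto
    then show ?thesis using 2 by force
  qed
qed simp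

lemma climbs_distinct: "climbs n u C \<Longrightarrow> distinct C"
proof (induction n u C rule: climbs.induct)
  case (2 n u i j C)
  have "(i, j) \<notin> set C"
    using 2 by (intro climbs_no_return[of n "swp u i j"]) (auto simp: cov_def swp_apply[of u i j])
  then show ?case using 2 by auto
qed simp

text \<open>Links from level \<open>k\<close> on never move the value at \<open>a\<close>, which at
  the end exceeds everything to its right. The induction generalises \<open>b\<close> because the
  value there may move.\<close>

lemma climbs_settled:
  assumes "climbs n u C" "\<forall>c\<in>set C. k \<le> fst c" "1 \<le> a" "a < k" "a < b" "b \<le> n"
  shows "u b < u a"
  using assms
proof (induction n u C arbitrary: b rule: climbs.induct)
  case (1 n u)
  then show ?case by (auto simp: longest_perm_def)
next
  case (2 n u i j C)
  have "a < transpose i j b" "transpose i j b \<le> n"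
    using 2 by (auto simp: transpose_def)
  then have "swp u i j (transpose i j b) < swp u i j a"
    using 2 by (intro 2(1)) auto
  then show ?case using 2 by (auto simp: swp_apply transpose_def split: if_splits)
qed

section \<open>Lower bounds for links and minimal markings\<close>

definition rk :: "nat \<Rightarrow> (nat \<Rightarrow> nat) \<Rightarrow> nat \<Rightarrow> nat" where
  "rk n u a = nat (dual_rajcode n u a)"

lemma Max_increasing_from:
  assumes "1 \<le> a" "a \<le> n"
  shows "\<exists>\<alpha>. increasing_from n u a \<alpha> \<and> length \<alpha> = Max {length \<alpha> | \<alpha>. increasing_from n u a \<alpha>}"
    and "increasing_from n u a \<beta> \<Longrightarrow> length \<beta> \<le> Max {length \<alpha> | \<alpha>. increasing_from n u a \<alpha>}"
proof -
  let ?S = "{length \<alpha> | \<alpha>. increasing_from n u a \<alpha>}"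
  have "length \<alpha> \<le> n" if "increasing_from n u a \<alpha>" for \<alpha>
  proof -
    have "distinct \<alpha>" "set \<alpha> \<subseteq> {1..n}"
      using that by (auto simp: increasing_from_def strict_sorted_iff)
    then show ?thesis using card_mono[of "{1..n}" "set \<alpha>"] by (simp add: distinct_card)
  qed
  then have fin: "finite ?S" by (intro finite_subset[of ?S "{..n}"]) auto
  have "increasing_from n u a [a]" using assms by (auto simp: increasing_from_def)
  then have "?S \<noteq> {}" by auto
  then have "Max ?S \<in> ?S" using fin by (rule Max_in[rotated])
  then show "\<exists>\<alpha>. increasing_from n u a \<alpha> \<and> length \<alpha> = Max ?S" by auto
  show "increasing_from n u a \<beta> \<Longrightarrow> length \<beta> \<le> Max ?S" using fin by (intro Max_ge) auto
qed

text \<open>The one-element sequence makes the maximum at least 1, so \<open>nat\<close> in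
  \<open>rk\<close> truncates nothing.\<close>

lemma dual_rajcode_eq_rk:
  assumes "1 \<le> a" "a \<le> n"
  shows "dual_rajcode n u a = int (rk n u a)"
proof -
  have "increasing_from n u a [a]" using assms by (auto simp: increasing_from_def)
  then have "1 \<le> Max {length \<alpha> | \<alpha>. increasing_from n u a \<alpha>}"
    using Max_increasing_from(2)[OF assms, of u "[a]"] by simp
  then show ?thesis by (simp add: rk_def dual_rajcode_def)
qed

lemma rk_attained:
  assumes "1 \<le> a" "a \<le> n"
  shows "\<exists>\<alpha>. increasing_from n u a \<alpha> \<and> length \<alpha> = Suc (rk n u a)"
  using Max_increasing_from(1)[OF assms, of u] dual_rajcode_eq_rk[OF assms, of u]
  unfolding dual_rajcode_def by force

lemma rk_upper:
  assumes "1 \<le> a" "a \<le> n" "increasing_from n u a \<alpha>"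
  shows "length \<alpha> \<le> Suc (rk n u a)"
  using Max_increasing_from(2)[OF assms] dual_rajcode_eq_rk[OF assms(1,2), of u]
  unfolding dual_rajcode_def by simp

text \<open>Prepend \<open>a\<close> to an optimal sequence from \<open>b\<close>. With
  \<open>rk_SucE\<close> this gives the recursion for \<open>rk\<close> through which later proofs
  argue instead of through sequences.\<close>

lemma Suc_rk_le:
  assumes "1 \<le> a" "a < b" "b \<le> n" "u a < u b"
  shows "Suc (rk n u b) \<le> rk n u a"
proof -
  obtain \<alpha> where \<alpha>: "increasing_from n u b \<alpha>" "length \<alpha> = Suc (rk n u b)"
    using rk_attained[of b n u] assms by auto
  then obtain \<beta> where \<beta>: "\<alpha> = b # \<beta>" by (cases \<alpha>) (auto simp: increasing_from_def)
  have "increasing_from n u a (a # \<alpha>)"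
    using \<alpha>(1) assms unfolding increasing_from_def \<beta> by (auto intro: less_trans)
  then show ?thesis using rk_upper[of a n u "a # \<alpha>"] assms \<alpha>(2) by simp
qed

lemma rk_SucE:
  assumes "1 \<le> a" "a \<le> n" "rk n u a = Suc r"
  obtains b where "a < b" "b \<le> n" "u a < u b" "rk n u b = r"
proof -
  obtain \<alpha> where \<alpha>: "increasing_from n u a \<alpha>" "length \<alpha> = Suc (Suc r)"
    using rk_attained[of a n u] assms by auto
  then obtain b \<beta> where \<beta>: "\<alpha> = a # b # \<beta>"
    by (auto simp: increasing_from_def length_Suc_conv)
  have b: "a < b" "b \<le> n" "u a < u b" "increasing_from n u b (b # \<beta>)"
    using \<alpha>(1) unfolding \<beta> by (auto simp: increasing_from_def)
  then have "r \<le> rk n u b" using rk_upper[OF _ _ b(4)] \<alpha>(2) assms(1) by (simp add: \<beta>)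
  moreover have "Suc (rk n u b) \<le> rk n u a" using assms b by (intro Suc_rk_le) auto
  ultimately show ?thesis using that b assms(3) by simp
qed

lemma rk_eq_0:
  assumes "1 \<le> a" "a \<le> n" "\<And>b. a < b \<Longrightarrow> b \<le> n \<Longrightarrow> u b < u a"
  shows "rk n u a = 0"
proof (rule ccontr)
  assume "rk n u a \<noteq> 0"
  then obtain r where r: "rk n u a = Suc r" using not0_implies_Suc by blast
  obtain b where "a < b" "b \<le> n" "u a < u b" using rk_SucE[OF assms(1,2) r] .
  then show False using assms(3)[of b] by simp
qed

text \<open>The dual form of \<open>invcode\<close> being at most \<open>rajcode\<close>: along a
  longest increasing sequence the sets counted by \<open>asc\<close> shrink strictly.\<close>

lemma rk_le_asc:
  assumes "1 \<le> a" "a \<le> n"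
  shows "rk n u a \<le> asc n u a"
  using assms
proof (induction "rk n u a" arbitrary: a)
  case (Suc r)
  obtain b where b: "a < b" "b \<le> n" "u a < u b" "rk n u b = r"
    using rk_SucE[OF Suc.prems Suc.hyps(2)[symmetric]] .
  have "insert b {c \<in> {b<..n}. u b < u c} \<subseteq> {c \<in> {a<..n}. u a < u c}" using b by auto
  then have "card (insert b {c \<in> {b<..n}. u b < u c}) \<le> asc n u a"
    unfolding asc_def by (intro card_mono) auto
  then have "Suc (asc n u b) \<le> asc n u a" by (simp add: asc_def)
  moreover have "r \<le> asc n u b" using Suc.hyps(1)[of b] b Suc.prems by simp
  ultimately show ?case using Suc.hyps(2) by simp
qed simp

lemma rk_mono:
  assumes "1 \<le> k" "k < a" "a \<le> n"
    and "\<And>b c. k < b \<Longrightarrow> b < c \<Longrightarrow> c \<le> n \<Longrightarrow> u b < u c \<Longrightarrow> v b < v c"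
  shows "rk n u a \<le> rk n v a"
  using assms(2,3)
proof (induction "rk n u a" arbitrary: a)
  case (Suc r)
  obtain b where b: "a < b" "b \<le> n" "u a < u b" "rk n u b = r"
    using rk_SucE[of a n u r] Suc.hyps(2) Suc.prems assms(1) by (metis le_trans less_imp_le)
  have "r \<le> rk n v b" using Suc b by auto
  moreover have "Suc (rk n v b) \<le> rk n v a"
    using Suc.prems b assms(1,4) by (intro Suc_rk_le) auto
  ultimately show ?case using Suc.hyps(2) by simp
qed simp

lemma asc_mono:
  assumes "k < a" "a \<le> n"
    and "\<And>b c. k < b \<Longrightarrow> b < c \<Longrightarrow> c \<le> n \<Longrightarrow> u b < u c \<Longrightarrow> v b < v c"
  shows "asc n u a \<le> asc n v a"
  unfolding asc_def using assms by (intro card_mono) auto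

text \<open>Right of \<open>i\<close> only the value at \<open>j\<close> changes, and it falls to
  \<open>u i\<close>. This can hurt only ascents \<open>(b, j)\<close>, and there \<open>cov\<close>
  gives \<open>u b < u i\<close> already.\<close>

lemma swp_tail_mono:
  assumes "cov u i j" "i < j" "i < b" "b < c" "u b < u c"
  shows "swp u i j b < swp u i j c"
proof -
  have "u b < u i \<or> u j < u b" if "b < j" using assms that by (auto simp: cov_def)
  then show ?thesis using assms by (auto simp: swp_apply cov_def)
qed

lemma cov_rk_mono: "\<lbrakk>1 \<le> i; i < j; cov u i j; i < a; a \<le> n\<rbrakk> \<Longrightarrow> rk n u a \<le> rk n (swp u i j) a"
  by (rule rk_mono[of i]) (auto intro: swp_tail_mono)

lemma cov_asc_mono: "\<lbrakk>i < j; cov u i j; i < a; a \<le> n\<rbrakk> \<Longrightarrow> asc n u a \<le> asc n (swp u i j) a"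
  by (rule asc_mono[of i]) (auto intro: swp_tail_mono)

lemma rk_swp_right:
  assumes "1 \<le> a" "a \<le> n" "i < j" "j < a"
  shows "rk n (swp u i j) a = rk n u a"
proof -
  have eq: "swp u i j b = u b" if "j < b" for b using that assms by (simp add: swp_apply)
  have "rk n (swp u i j) a \<le> rk n u a"
    by (rule rk_mono[of j]) (use assms eq in auto)
  moreover have "rk n u a \<le> rk n (swp u i j) a"
    by (rule rk_mono[of j]) (use assms eq in auto)
  ultimately show ?thesis by simp
qed

text \<open>Links below level \<open>k\<close> do not lower the tail sum. At the first link of level
  at least \<open>k\<close>, all remaining links count, and they are as many as all remaining
  ascents.\<close>

lemma tail_asc_le_links:
  assumes "climbs n u C" "u permutes {1..n}" "1 \<le> k"
  shows "(\<Sum>a\<in>{k..n}. asc n u a) \<le> length (filter (\<lambda>c. k \<le> fst c) C)"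
  using assms(1,2)
proof (induction n u C rule: climbs.induct)
  case (1 n u)
  have "asc n u a = 0" if "a \<in> {k..n}" for a
    using 1 that assms(3) by (auto simp: asc_def longest_perm_def)
  then show ?case by simp
next
  case (2 n u i j C)
  show ?case
  proof (cases "k \<le> i")
    case True
    have "(\<Sum>a\<in>{k..n}. asc n u a) \<le> (\<Sum>a\<in>{1..n}. asc n u a)"
      using assms(3) by (intro sum_mono2) auto
    also have "\<dots> = length ((i, j) # C)" using climbs_length[OF 2(2,3)] by (simp add: card_ascents)
    also have "\<dots> = length (filter (\<lambda>c. k \<le> fst c) ((i, j) # C))"
      using 2(2) True by (subst filter_True) auto
    finally show ?thesis .
  next
    case False
    have "(\<Sum>a\<in>{k..n}. asc n u a) \<le> (\<Sum>a\<in>{k..n}. asc n (swp u i j) a)"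
      using 2(2) False by (intro sum_mono cov_asc_mono) auto
    also have "\<dots> \<le> length (filter (\<lambda>c. k \<le> fst c) C)"
      using 2(2,3) by (intro 2(1) permutes_comp_transpose) auto
    finally show ?thesis using False by simp
  qed
qed

section \<open>Minimal markings as a list, and the potential argument\<close>

definition is_marked :: "nat \<times> nat \<Rightarrow> nat \<times> nat \<Rightarrow> bool" where
  "is_marked p c \<longleftrightarrow> fst p < fst c \<or> fst p = fst c \<and> snd p < snd c"

fun marks :: "nat \<times> nat \<Rightarrow> (nat \<times> nat) list \<Rightarrow> (nat \<times> nat) list" where
  "marks p [] = []"
| "marks p (c # C) = (if is_marked p c then [c] else []) @ marks c C"

lemma set_marks_subset: "set (marks p C) \<subseteq> set C"
  by (induction p C rule: marks.induct) auto

lemma distinct_marks: "distinct C \<Longrightarrow> distinct (marks p C)"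
  by (induction p C rule: marks.induct) (use set_marks_subset in auto)

lemma in_set_marks_iff:
  "x \<in> set (marks p C) \<longleftrightarrow> (\<exists>q<length C. is_marked ((p # C) ! q) (C ! q) \<and> x = C ! q)"
  by (induction p C rule: marks.induct) (auto simp: Ex_less_Suc2)

text \<open>The fictitious link \<open>(0, 0)\<close> encodes the convention i_0 = 0: levels are at
  least 1, so the first link always counts as marked.\<close>

lemma min_markings_eq:
  assumes "\<forall>c\<in>set C. 1 \<le> fst c"
  shows "min_markings C = set (marks (0, 0) C)"
proof -
  have "(q = 0 \<or> fst (C ! (q - 1)) < fst (C ! q) \<or>
         fst (C ! (q - 1)) = fst (C ! q) \<and> snd (C ! (q - 1)) < snd (C ! q)) \<longleftrightarrow>
         is_marked (((0, 0) # C) ! q) (C ! q)" if "q < length C" for q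
  proof (cases q)
    case 0
    then show ?thesis using that assms nth_mem[OF that] by (simp add: is_marked_def Suc_le_eq)
  qed (simp add: is_marked_def)
  then show ?thesis
    unfolding min_markings_def set_eq_iff in_set_marks_iff mem_Collect_eq by metis
qed

lemma rk_settled:
  assumes "climbs n u C" "\<forall>c\<in>set C. k \<le> fst c" "1 \<le> a" "a < k" "a \<le> n"
  shows "rk n u a = 0"
  using climbs_settled[OF assms(1-4)] assms(3,5) by (intro rk_eq_0) auto

lemma rk_longest_perm:
  assumes "1 \<le> a" "a \<le> n"
  shows "rk n (longest_perm n) a = 0"
  using assms by (intro rk_eq_0) (auto simp: longest_perm_def)

text \<open>The rank sum right of \<open>i\<close> grows at least by the gain at \<open>j\<close>,
  stated without subtraction of naturals.\<close>

lemma sum_rk_swp: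
  assumes "1 \<le> i" "i < j" "j \<le> n" "cov u i j"
  shows "(\<Sum>a\<in>{i<..n}. rk n u a) + rk n (swp u i j) j \<le> (\<Sum>a\<in>{i<..n}. rk n (swp u i j) a) + rk n u j"
proof -
  have "(\<Sum>a\<in>{i<..n} - {j}. rk n u a) \<le> (\<Sum>a\<in>{i<..n} - {j}. rk n (swp u i j) a)"
    using assms by (intro sum_mono cov_rk_mono) auto
  moreover have "(\<Sum>a\<in>{i<..n}. f a) = f j + (\<Sum>a\<in>{i<..n} - {j}. f a)" for f :: "nat \<Rightarrow> nat"
    using assms by (intro sum.remove) auto
  ultimately show ?thesis by simp
qed

text \<open>\<open>(i, J)\<close> is the link used before \<open>C\<close>, or \<open>J = i\<close> if level \<open>i\<close> has not started. The potential
  that each marked link lowers by at most one, and no unmarked link lowers, is the rank sum to the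
  right of \<open>i\<close> plus the best \<open>q\<close>. Only larger values to the right of \<open>J\<close> count in full:
  those to its left can be reached by unmarked links.\<close>

lemma marks_lower_bound:
  assumes "climbs n u C" "\<forall>c\<in>set C. i \<le> fst c" "1 \<le> i" "i \<le> n" "i \<le> J"
    and "q = 0 \<or> Suc q \<le> rk n u i \<or> (\<exists>m. J < m \<and> m \<le> n \<and> u i < u m \<and> q \<le> Suc (rk n u m))"
  shows "(\<Sum>a\<in>{i<..n}. rk n u a) + q \<le> length (marks (i, J) C)"
  using assms
proof (induction n u C arbitrary: i J q rule: climbs.induct)
  case (1 n u)
  have "rk n u a = 0" if "a \<in> {i..n}" for a
    using 1 that by (auto intro: rk_longest_perm)
  moreover have "\<not> u i < u m" if "J < m" "m \<le> n" for m
    using 1 that by (auto simp: longest_perm_def)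
  ultimately show ?case using 1 by auto
next
  case (2 n u i' j C)
  define v where "v = swp u i' j"
  define L where "L = length (marks (i', j) C)"
  have ij: "1 \<le> i'" "i' < j" "j \<le> n" "cov u i' j" "u i' < u j"
    using 2(2) by (auto simp: cov_def)
  have vr: "v m = u m" if "j < m" for m
    using ij that by (auto simp: v_def swp_apply)
  have vj: "v j = u i'" and vi: "v i' = u j" using ij by (auto simp: v_def swp_apply)
  have rr: "rk n v m = rk n u m" if "j < m" "m \<le> n" for m
    unfolding v_def using ij that by (intro rk_swp_right) auto
  have T: "(\<Sum>a\<in>{i'<..n}. rk n u a) + rk n v j \<le> (\<Sum>a\<in>{i'<..n}. rk n v a) + rk n u j"
    unfolding v_def using ij by (intro sum_rk_swp) auto
  have "rk n u j \<le> rk n v j" unfolding v_def using ij by (intro cov_rk_mono) auto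
  with T have T': "(\<Sum>a\<in>{i'<..n}. rk n u a) \<le> (\<Sum>a\<in>{i'<..n}. rk n v a)" by simp
  have IH: "(\<Sum>a\<in>{i'<..n}. rk n v a) + q \<le> L"
    if "q = 0 \<or> Suc q \<le> rk n v i' \<or> (\<exists>m. j < m \<and> m \<le> n \<and> v i' < v m \<and> q \<le> Suc (rk n v m))" for q
    unfolding L_def v_def using 2(2) that ij by (intro 2(1)) (auto simp: v_def)
  \<comment> \<open>Level \<open>i'\<close> now holds the value \<open>u j\<close>, and the second
    position of a longest increasing sequence from \<open>j\<close> lies right of \<open>j\<close>,
    so \<open>rk n u j\<close> is an admissible debt after the swap.\<close>
  have "(\<Sum>a\<in>{i'<..n}. rk n v a) + rk n u j \<le> L"
  proof (rule IH, cases "rk n u j")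
    case (Suc s)
    obtain m where "j < m" "m \<le> n" "u j < u m" "rk n u m = s"
      using rk_SucE[OF _ _ Suc] ij by auto
    then have "\<exists>m. j < m \<and> m \<le> n \<and> v i' < v m \<and> rk n u j \<le> Suc (rk n v m)"
      using Suc rr vr vi by (intro exI[of _ m]) auto
    then show "rk n u j = 0 \<or> Suc (rk n u j) \<le> rk n v i' \<or>
       (\<exists>m. j < m \<and> m \<le> n \<and> v i' < v m \<and> rk n u j \<le> Suc (rk n v m))" by blast
  qed simp
  with T have *: "(\<Sum>a\<in>{i'<..n}. rk n u a) + rk n v j \<le> L" by simp
  \<comment> \<open>This serves a marked link, which may pay one unit. With \<open>m\<close> the
    second position of a longest sequence from \<open>i'\<close>: right of \<open>j\<close>, the
    gain at \<open>j\<close> covers the debt; at \<open>j\<close>, the previous bound does; left of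
    \<open>j\<close>, \<open>cov\<close> puts \<open>u m\<close> above \<open>u j\<close>, so
    \<open>i'\<close> keeps enough rank.\<close>
  have A: "(\<Sum>a\<in>{i'<..n}. rk n u a) + rk n u i' \<le> Suc L"
  proof (cases "rk n u i'")
    case (Suc r)
    obtain m where m: "i' < m" "m \<le> n" "u i' < u m" "rk n u m = r"
      using rk_SucE[OF _ _ Suc] ij by auto
    consider "j < m" | "m = j" | "m < j" by linarith
    then show ?thesis
    proof cases
      case 1
      then have "Suc (rk n v m) \<le> rk n v j" using m vj vr ij by (intro Suc_rk_le) auto
      then show ?thesis using * rr[OF 1] m Suc by simp
    next
      case 2
      then show ?thesis using \<open>(\<Sum>a\<in>{i'<..n}. rk n v a) + rk n u j \<le> L\<close> T' m Suc by simp
    next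
      case 3
      then have "u j < u m" "v m = u m" using m ij(4) by (auto simp: cov_def v_def swp_apply)
      then have "Suc (rk n v m) \<le> rk n v i'" using m vi ij by (intro Suc_rk_le) auto
      moreover have "r \<le> rk n v m"
        using cov_rk_mono[of i' j u m n] m ij by (simp add: v_def)
      ultimately have "(\<Sum>a\<in>{i'<..n}. rk n v a) + r \<le> L" by (intro IH) simp
      then show ?thesis using T' Suc by simp
    qed
  qed (use * in simp)
  have "i \<le> i'" using 2(3) by simp
  show ?case
  proof (cases "i' = i")
    \<comment> \<open>Level \<open>i\<close> is over: its value and those up to \<open>i'\<close>
      are final, so their ranks vanish and nothing is owed. The first link of the new level is
      marked.\<close>
    case False
    then have "i < i'" using \<open>i \<le> i'\<close> by simp
    have ge: "\<forall>c\<in>set ((i', j) # C). i' \<le> fst c" using 2(2) by auto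
    have z: "rk n u a = 0" if "i \<le> a" "a < i'" for a
      using rk_settled[OF 2(2) ge] that 2(4) ij by auto
    have "\<not> u i < u m" if "J < m" "m \<le> n" for m
      using climbs_settled[OF 2(2) ge, of i m] that 2(4,6) \<open>i < i'\<close> by auto
    then have "q = 0" using 2(7) z[of i] \<open>i < i'\<close> by auto
    moreover have "(\<Sum>a\<in>{i<..n}. rk n u a) = (\<Sum>a\<in>insert i' {i'<..n}. rk n u a)"
    proof (intro sum.mono_neutral_right ballI)
      fix a assume "a \<in> {i<..n} - insert i' {i'<..n}"
      then show "rk n u a = 0" by (intro z) auto
    qed (use \<open>i < i'\<close> ij in auto)
    ultimately show ?thesis using A \<open>i < i'\<close> by (simp add: is_marked_def L_def add.commute)
  next
    case True
    show ?thesis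
    proof (cases "J < j")
      case J: True
      have "q \<le> rk n u i"
        using 2(7)
      proof (elim disjE exE)
        fix m assume m: "J < m \<and> m \<le> n \<and> u i < u m \<and> q \<le> Suc (rk n u m)"
        then have "Suc (rk n u m) \<le> rk n u i" using 2(4,6) by (intro Suc_rk_le) auto
        then show ?thesis using m by simp
      qed auto
      then show ?thesis using A J True by (simp add: is_marked_def L_def)
    next
      \<comment> \<open>The link is unmarked, so all of \<open>q\<close> must survive. A witness
        \<open>m\<close> right of \<open>J\<close> either still exceeds the new value at
        \<open>i\<close>, or lies above the value now at \<open>j\<close> and is paid for by the
        rank gained there. The spare unit in \<open>Suc q\<close> absorbs the one in
        \<open>A\<close>.\<close>
      case J: False
      have "(\<Sum>a\<in>{i'<..n}. rk n u a) + q \<le> L"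
        using 2(7)
      proof (elim disjE exE)
        fix m assume m: "J < m \<and> m \<le> n \<and> u i < u m \<and> q \<le> Suc (rk n u m)"
        then have jm: "j < m" using J by simp
        show ?thesis
        proof (cases "u j < u m")
          case True
          then have "\<exists>m. j < m \<and> m \<le> n \<and> v i' < v m \<and> q \<le> Suc (rk n v m)"
            using m jm rr vr vi by (intro exI[of _ m]) auto
          then show ?thesis using IH[of q] T' by auto
        next
          case False
          have "Suc (rk n v m) \<le> rk n v j"
            using m jm vj vr ij \<open>i' = i\<close> by (intro Suc_rk_le) auto
          then show ?thesis using * rr[OF jm] m by simp
        qed
      qed (use A * True in auto)
      then show ?thesis using J True by (simp add: is_marked_def L_def)
    qed
  qed
qed

text \<open>Ranks only grow until the first link of some level \<open>i\<close> at least
  \<open>k\<close>. That link is marked, as it would be after \<open>(i, i)\<close>, so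
  \<open>marks_lower_bound\<close> applies with the full rank of \<open>i\<close> as debt; positions
  from \<open>k\<close> up to \<open>i\<close> are settled and contribute 0.\<close>

lemma tail_rk_le_marks:
  assumes "climbs n u C" "1 \<le> k" "fst p < k"
  shows "(\<Sum>a\<in>{k..n}. rk n u a) \<le> length (filter (\<lambda>c. k \<le> fst c) (marks p C))"
  using assms
proof (induction n u C arbitrary: p rule: climbs.induct)
  case (1 n u)
  then show ?case by (simp add: rk_longest_perm)
next
  case (2 n u i j C)
  show ?case
  proof (cases "k \<le> i")
    case True
    have ge: "\<forall>c\<in>set ((i, j) # C). i \<le> fst c" using 2(2) by auto
    have in_: "1 \<le> i" "i \<le> n" "i < j" using 2(2) by auto
    have "rk n u i = 0 \<or> (\<exists>m>i. m \<le> n \<and> u i < u m \<and> rk n u i \<le> Suc (rk n u m))"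
    proof (cases "rk n u i")
      case (Suc r)
      obtain m where "i < m" "m \<le> n" "u i < u m" "rk n u m = r"
        using rk_SucE[OF in_(1,2) Suc] .
      then show ?thesis using Suc by auto
    qed simp
    then have "(\<Sum>a\<in>{i<..n}. rk n u a) + rk n u i \<le> length (marks (i, i) ((i, j) # C))"
      using in_ by (intro marks_lower_bound[OF 2(2) ge]) auto
    moreover have "(\<Sum>a\<in>{k..n}. rk n u a) = (\<Sum>a\<in>insert i {i<..n}. rk n u a)"
    proof (intro sum.mono_neutral_right ballI)
      fix a assume "a \<in> {k..n} - insert i {i<..n}"
      then show "rk n u a = 0" using rk_settled[OF 2(2) ge] 2(3) by auto
    qed (use True in_ in auto)
    moreover have "marks p ((i, j) # C) = marks (i, i) ((i, j) # C)"
      using True 2(4) in_ by (simp add: is_marked_def)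
    moreover have "filter (\<lambda>c. k \<le> fst c) (marks p ((i, j) # C)) = marks p ((i, j) # C)"
      using set_marks_subset[of p "(i, j) # C"] ge True by (intro filter_True) fastforce
    ultimately show ?thesis by (simp add: add.commute)
  next
    case False
    have "(\<Sum>a\<in>{k..n}. rk n u a) \<le> (\<Sum>a\<in>{k..n}. rk n (swp u i j) a)"
      using 2(2) False by (intro sum_mono cov_rk_mono) auto
    also have "\<dots> \<le> length (filter (\<lambda>c. k \<le> fst c) (marks (i, j) C))"
      using 2(2,3) False by (intro 2(1)) auto
    finally show ?thesis using False by simp
  qed
qed

section \<open>Chains with prescribed markings\<close>

text \<open>The hypothesis \<open>good\<close> is shared by both swaps of the construction: it is
  vacuous for the next larger value, and follows from the choice of the rightmost position of
  maximal rank.\<close>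

lemma cov_if_no_larger_rk:
  assumes "inj u" "i < j" "j \<le> n" "u i < u j"
    and good: "\<And>m. i < m \<Longrightarrow> m \<le> n \<Longrightarrow> u i < u m \<Longrightarrow> u m < u j \<Longrightarrow> j < m \<and> rk n u m < rk n u j"
  shows "cov u i j"
  unfolding cov_def
proof (intro conjI allI impI)
  fix b assume b: "i < b \<and> b < j"
  then have "u b \<noteq> u i" "u b \<noteq> u j" using assms(1) by (metis injD less_irrefl)+
  then show "u b < u i \<or> u j < u b" using good[of b] b assms(3) by force
qed fact

text \<open>Swapping lowers the value at \<open>j\<close> to \<open>u i\<close>; the positions this puts above \<open>j\<close> have too small
  a rank to lengthen an increasing sequence.\<close>

lemma rk_swp_eq:
  assumes "inj u" "1 \<le> i" "i < j" "j \<le> n" "u i < u j"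
    and good: "\<And>m. i < m \<Longrightarrow> m \<le> n \<Longrightarrow> u i < u m \<Longrightarrow> u m < u j \<Longrightarrow> j < m \<and> rk n u m < rk n u j"
    and "i < a" "a \<le> n"
  shows "rk n (swp u i j) a = rk n u a"
proof (rule antisym)
  have cov: "cov u i j" using cov_if_no_larger_rk[OF assms(1,3,4,5) good] .
  show "rk n u a \<le> rk n (swp u i j) a"
    using assms cov by (intro cov_rk_mono) auto
  define v where "v = swp u i j"
  have v: "v j = u i" "\<And>b. i < b \<Longrightarrow> b \<noteq> j \<Longrightarrow> v b = u b"
    using assms(3) by (auto simp: v_def swp_apply)
  have "rk n v a \<le> rk n u a" using assms(7,8)
  proof (induction "rk n v a" arbitrary: a)
    case (Suc r)
    have a: "1 \<le> a" using Suc.prems by simp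
    obtain b where b: "a < b" "b \<le> n" "v a < v b" "rk n v b = r"
      using rk_SucE[OF a Suc.prems(2) Suc.hyps(2)[symmetric]] .
    have r: "r \<le> rk n u b" using Suc.hyps(1)[of b] b Suc.prems by simp
    show ?case
    proof (cases "u a < u b")
      case True
      then have "Suc (rk n u b) \<le> rk n u a" using b a by (intro Suc_rk_le) auto
      then show ?thesis using r Suc.hyps(2) by simp
    next
      case False
      have "u a \<noteq> u b" using b assms(1) by (metis injD less_irrefl)
      have "b \<noteq> j"
      proof
        assume "b = j"
        then show False using False b v(1) v(2)[of a] Suc.prems assms(5) by simp
      qed
      then have vb: "v b = u b" using b Suc.prems by (intro v(2)) auto
      \<comment> \<open>A new ascent right of \<open>i\<close> can only start at \<open>j\<close>,
        the one position there whose value fell.\<close>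
      then have "a = j" using False b(3) v(2)[of a] Suc.prems by force
      then have "rk n u b < rk n u a"
        using good[of b] b v(1) vb False \<open>u a \<noteq> u b\<close> Suc.prems by simp
      then show ?thesis using r Suc.hyps(2) by simp
    qed
  qed simp
  then show "rk n (swp u i j) a \<le> rk n u a" by (simp add: v_def)
qed

text \<open>The value at \<open>i\<close> rises, so fewer continuations remain; but those of
  \<open>j\<close> are now open to \<open>i\<close>. If \<open>j\<close> has rank one less than
  \<open>i\<close>, the rank of \<open>i\<close> drops by at most one.\<close>

lemma rk_swp_self:
  assumes "1 \<le> i" "i < j" "j \<le> n" "u i < u j"
    and "\<And>a. i < a \<Longrightarrow> a \<le> n \<Longrightarrow> rk n (swp u i j) a = rk n u a"
  shows "rk n (swp u i j) i \<le> rk n u i" "rk n u j \<le> rk n (swp u i j) i"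
proof -
  define v where "v = swp u i j"
  have v: "v i = u j" "v j = u i" "\<And>b. i < b \<Longrightarrow> b \<noteq> j \<Longrightarrow> v b = u b"
    using assms(2) by (auto simp: v_def swp_apply)
  have i: "i \<le> n" using assms by simp
  have "rk n v i \<le> rk n u i"
  proof (cases "rk n v i")
    case (Suc s)
    obtain m where m: "i < m" "m \<le> n" "v i < v m" "rk n v m = s"
      using rk_SucE[OF assms(1) i Suc] .
    then have "m \<noteq> j" using v assms(4) by auto
    then have "Suc (rk n u m) \<le> rk n u i"
      using m v assms(1,4) by (intro Suc_rk_le) auto
    then show ?thesis using m assms(5)[of m] Suc by (simp add: v_def)
  qed simp
  then show "rk n (swp u i j) i \<le> rk n u i" by (simp add: v_def)
  have "rk n u j \<le> rk n v i"
  proof (cases "rk n u j")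
    case (Suc s)
    obtain m where m: "j < m" "m \<le> n" "u j < u m" "rk n u m = s"
      using rk_SucE[OF _ assms(3) Suc] assms by auto
    then have "Suc (rk n v m) \<le> rk n v i"
      using v assms by (intro Suc_rk_le) auto
    then show ?thesis using m assms(2) assms(5)[of m] Suc by (simp add: v_def)
  qed simp
  then show "rk n u j \<le> rk n (swp u i j) i" by (simp add: v_def)
qed

text \<open>No value right of \<open>i\<close> lies strictly between \<open>u i\<close> and
  \<open>u j\<close>, so replacing \<open>u j\<close> by \<open>u i\<close> at \<open>j\<close>
  changes no comparison there.\<close>

lemma asc_swp_eq:
  assumes "inj u" "i < j" "j \<le> n" "u i < u j"
    and none: "\<And>m. i < m \<Longrightarrow> m \<le> n \<Longrightarrow> u i < u m \<Longrightarrow> u j \<le> u m"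
  shows "i < a \<Longrightarrow> a \<le> n \<Longrightarrow> asc n (swp u i j) a = asc n u a"
    and "asc n u i = Suc (asc n (swp u i j) i)"
proof -
  define v where "v = swp u i j"
  have v: "v i = u j" "v j = u i" "\<And>b. i < b \<Longrightarrow> b \<noteq> j \<Longrightarrow> v b = u b"
    using assms(2) by (auto simp: v_def swp_apply)
  have iff: "v b < v c \<longleftrightarrow> u b < u c" if "i < b" "b < c" "c \<le> n" for b c
  proof -
    have "u b \<noteq> u i" "u c \<noteq> u i" "u c \<noteq> u b" using that assms(1) by (metis injD less_irrefl order.strict_trans)+
    moreover have "u b < u i \<or> u j \<le> u b" "u c < u i \<or> u j \<le> u c"
      using none[of b] none[of c] that \<open>u b \<noteq> u i\<close> \<open>u c \<noteq> u i\<close> by linarith+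
    ultimately show ?thesis
      using that v(2) v(3)[of b] v(3)[of c] assms(4)
      by (cases "b = j"; cases "c = j") auto
  qed
  show "asc n (swp u i j) a = asc n u a" if "i < a" "a \<le> n"
  proof -
    have "{b \<in> {a<..n}. v a < v b} = {b \<in> {a<..n}. u a < u b}" using iff[of a] that by auto
    then show ?thesis by (simp add: asc_def v_def)
  qed
  have iff': "v i < v b \<longleftrightarrow> u i < u b \<and> b \<noteq> j" if "i < b" "b \<le> n" for b
  proof -
    have "u b \<noteq> u j" if "b \<noteq> j" using that assms(1) by (metis injD)
    then show ?thesis using that v(1,2) v(3)[of b] none[of b] assms(4) by (cases "b = j") auto
  qed
  have "{b \<in> {i<..n}. u i < u b} = insert j {b \<in> {i<..n}. v i < v b}"
    using iff' assms(2-4) by auto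
  moreover have "j \<notin> {b \<in> {i<..n}. v i < v b}" using iff'[of j] by auto
  ultimately show "asc n u i = Suc (asc n (swp u i j) i)" by (simp add: asc_def v_def)
qed

section \<open>Building a chain level by level\<close>

definition settled :: "nat \<Rightarrow> (nat \<Rightarrow> nat) \<Rightarrow> nat \<Rightarrow> bool" where
  "settled n u k \<longleftrightarrow> (\<forall>a. 1 \<le> a \<and> a < k \<longrightarrow> u a = n + 1 - a)"

text \<open>The value n + 1 - k is not before \<open>k\<close>, where larger values sit; were it
  after \<open>k\<close>, then \<open>u k\<close> would be larger still and hence already used
  before \<open>k\<close>.\<close>

lemma settled_Suc:
  assumes "u permutes {1..n}" "settled n u k" "1 \<le> k" "k \<le> n"
    and "\<And>b. k < b \<Longrightarrow> b \<le> n \<Longrightarrow> \<not> u k < u b"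
  shows "settled n u (Suc k)"
proof -
  have inj: "inj u" using assms(1) by (rule permutes_inj)
  have "n + 1 - k \<in> u ` {1..n}" using permutes_image[OF assms(1)] assms(3,4) by auto
  then obtain m where m: "1 \<le> m" "m \<le> n" "u m = n + 1 - k" by auto
  have "\<not> m < k" using m assms(2-4) by (auto simp: settled_def)
  moreover have "\<not> k < m"
  proof
    assume km: "k < m"
    then have "u m < u k" using assms(5)[of m] m inj by (metis injD less_irrefl linorder_neqE_nat)
    have uk: "1 \<le> u k" "u k \<le> n" using permutes_in_image[OF assms(1), of k] assms(3,4) by auto
    define a where "a = n + 1 - u k"
    have a: "1 \<le> a" "a < k" "n + 1 - a = u k"
      using uk \<open>u m < u k\<close> m assms(4) by (auto simp: a_def)
    then have "u a = u k" using assms(2) by (simp add: settled_def)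
    then show False using inj a(2) by (metis injD less_irrefl)
  qed
  ultimately have "m = k" by simp
  then show ?thesis using m assms(2) by (auto simp: settled_def less_Suc_eq)
qed

lemma settled_all:
  assumes "u permutes {1..n}" "settled n u (Suc n)"
  shows "u = longest_perm n"
  using assms permutes_not_in[OF assms(1)] by (fastforce simp: settled_def longest_perm_def)

lemma settled_swp:
  assumes "settled n u i" "i < j"
  shows "settled n (swp u i j) i"
  using assms by (auto simp: settled_def swp_apply)

definition level_marks :: "nat \<Rightarrow> nat \<times> nat \<Rightarrow> (nat \<times> nat) list \<Rightarrow> nat" where
  "level_marks a p C = length (filter (\<lambda>c. fst c = a) (marks p C))"

definition level_links :: "nat \<Rightarrow> (nat \<times> nat) list \<Rightarrow> nat" where
  "level_links a C = length (filter (\<lambda>c. fst c = a) C)"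

lemma level_marks_eq_0: "\<forall>c\<in>set C. k \<le> fst c \<Longrightarrow> a < k \<Longrightarrow> level_marks a p C = 0"
  using set_marks_subset[of p C] by (fastforce simp: level_marks_def filter_empty_conv)

lemma level_marks_Cons:
  "level_marks a p ((i, j) # C) = (if i = a \<and> is_marked p (i, j) then 1 else 0) + level_marks a (i, j) C"
  by (simp add: level_marks_def)

lemma level_links_Cons:
  "level_links a ((i, j) # C) = (if i = a then 1 else 0) + level_links a C"
  by (simp add: level_links_def)

text \<open>\<open>p\<close> is the link preceding \<open>C\<close>; it decides whether the first link of \<open>C\<close> is minimally marked.\<close>

definition realizes ::
  "nat \<Rightarrow> (nat \<Rightarrow> nat) \<Rightarrow> nat \<Rightarrow> nat \<times> nat \<Rightarrow> (nat \<Rightarrow> nat) \<Rightarrow> (nat \<times> nat) list \<Rightarrow> bool" where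
  "realizes n u k p f C \<longleftrightarrow> climbs n u C \<and> (\<forall>c\<in>set C. k \<le> fst c) \<and>
     (\<forall>a\<in>{k..n}. level_marks a p C \<le> f a \<and> f a \<le> level_links a C)"

lemma realizes_Suc:
  assumes "realizes n u (Suc k) p f C" "f k = 0"
  shows "realizes n u k p f C"
proof -
  have ge: "\<forall>c\<in>set C. Suc k \<le> fst c" using assms(1) by (simp add: realizes_def)
  have "level_marks a p C \<le> f a \<and> f a \<le> level_links a C" if "a \<in> {k..n}" for a
  proof (cases "a = k")
    case True
    then show ?thesis using assms(2) level_marks_eq_0[OF ge] by simp
  next
    case False
    then show ?thesis using assms(1) that by (simp add: realizes_def)
  qed
  then show ?thesis using assms(1) ge by (auto simp: realizes_def)
qed

text \<open>At level \<open>k\<close>, always swap with the rightmost larger value of maximal rank: among the values of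
  one rank these are visited from right to left, so only the first visit is marked. The second
  conjunct is the case where that first visit has already happened.\<close>

lemma level_chain_exists:
  assumes "u permutes {1..n}" "settled n u k" "1 \<le> k" "k \<le> Suc n" "fst p \<le> k"
  shows "\<exists>C. realizes n u k p (rk n u) C \<and>
    (\<forall>b. Suc b = rk n u k \<and> fst p = k \<and>
       (\<forall>m. snd p < m \<and> m \<le> n \<and> u k < u m \<longrightarrow> rk n u m \<noteq> b) \<longrightarrow> level_marks k p C \<le> b)"
  using assms
\<comment> \<open>A swap lowers the first summand, closing a level the second.\<close>
proof (induction "card (ascents n u) + (Suc n - k)" arbitrary: u k p rule: less_induct)
  case less
  have inj: "inj u" using less.prems(1) by (rule permutes_inj)
  consider "k = Suc n" | "k \<le> n" "rk n u k = 0" | r where "k \<le> n" "rk n u k = Suc r"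
    using less.prems(4) by (metis le_SucE not0_implies_Suc)
  then show ?case
  proof cases
    case 1
    then have "u = longest_perm n" using settled_all less.prems by simp
    then show ?thesis using 1 by (intro exI[of _ "[]"]) (simp add: realizes_def level_marks_def)
  next
    case 2
    have "\<not> u k < u b" if "k < b" "b \<le> n" for b
      using Suc_rk_le[of k b n u] 2(2) that less.prems(3) by auto
    then have "settled n u (Suc k)" using less.prems 2 by (intro settled_Suc) auto
    then obtain C where "realizes n u (Suc k) p (rk n u) C"
      using less.hyps[of u "Suc k" p] less.prems 2 by fastforce
    then have "realizes n u k p (rk n u) C" using 2(2) by (rule realizes_Suc)
    then show ?thesis using 2(2) by auto
  next
    case 3
    let ?J = "{m. k < m \<and> m \<le> n \<and> u k < u m \<and> rk n u m = r}"
    define j where "j = Max ?J"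
    have fin: "finite ?J" by (rule finite_subset[of _ "{..n}"]) auto
    obtain m where "m \<in> ?J" using rk_SucE[OF less.prems(3) 3] by auto
    then have "j \<in> ?J" unfolding j_def by (intro Max_in fin) auto
    then have j: "k < j" "j \<le> n" "u k < u j" "rk n u j = r" by auto
    have jmax: "m \<le> j" if "k < m" "m \<le> n" "u k < u m" "rk n u m = r" for m
      unfolding j_def using that by (intro Max_ge fin) auto
    \<comment> \<open>Larger values right of \<open>k\<close> have rank at most \<open>r\<close>.
      One below \<open>u j\<close> and left of \<open>j\<close> would have rank above
      \<open>r\<close>; right of \<open>j\<close>, rank \<open>r\<close> contradicts the choice of
      \<open>j\<close>.\<close>
    have good: "j < m \<and> rk n u m < rk n u j" if "k < m" "m \<le> n" "u k < u m" "u m < u j" for m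
    proof -
      have "Suc (rk n u m) \<le> rk n u k" using that less.prems(3) by (intro Suc_rk_le) auto
      moreover have "j < m"
      proof (rule ccontr)
        assume "\<not> j < m"
        moreover have "m \<noteq> j" using that by auto
        ultimately have "Suc (rk n u j) \<le> rk n u m" using that j less.prems(3) by (intro Suc_rk_le) auto
        then show False using \<open>Suc (rk n u m) \<le> rk n u k\<close> j 3 by simp
      qed
      moreover have "rk n u m \<noteq> r" using jmax[of m] that \<open>j < m\<close> by auto
      ultimately show ?thesis using j 3 by simp
    qed
    define v where "v = swp u k j"
    have cov: "cov u k j" using cov_if_no_larger_rk[OF inj j(1-3) good] .
    have tail: "rk n v a = rk n u a" if "k < a" "a \<le> n" for a
      unfolding v_def using rk_swp_eq[OF inj less.prems(3) j(1-3) good that] .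
    have self: "rk n v k \<le> Suc r" "r \<le> rk n v k"
      using rk_swp_self[OF less.prems(3) j(1-3)] tail j(4) 3 unfolding v_def by auto
    have perm: "v permutes {1..n}"
      unfolding v_def using less.prems j by (intro permutes_comp_transpose) auto
    have "card (ascents n u) = Suc (card (ascents n v))"
      unfolding v_def using less.prems j cov inj by (intro card_ascents_cov) auto
    then obtain C where C: "realizes n v k (k, j) (rk n v) C"
      and Cb: "\<And>b. Suc b = rk n v k \<Longrightarrow> (\<forall>m. j < m \<and> m \<le> n \<and> v k < v m \<longrightarrow> rk n v m \<noteq> b)
         \<Longrightarrow> level_marks k (k, j) C \<le> b"
      using less.hyps[of v k "(k, j)"] perm settled_swp[OF less.prems(2) j(1)] less.prems(3,4)
      by (auto simp: v_def)
    \<comment> \<open>If the rank of \<open>k\<close> did not drop, the next target again has rank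
      \<open>r\<close>, and no candidate of that rank is left beyond \<open>j\<close>; the second
      conjunct then saves one mark.\<close>
    have le_r: "level_marks k (k, j) C \<le> r"
    proof (cases "rk n v k = Suc r")
      case True
      have "rk n v m \<noteq> r" if m: "j < m" "m \<le> n" "v k < v m" for m
      proof -
        have "v k = u j" "v m = u m" using m j by (auto simp: v_def swp_apply)
        then show ?thesis using jmax[of m] m j tail[of m] by auto
      qed
      then show ?thesis using Cb[of r] True by auto
    next
      case False
      have "level_marks k (k, j) C \<le> rk n v k" using C 3(1) by (simp add: realizes_def)
      then show ?thesis using False self by simp
    qed
    have C': "climbs n v C" "\<forall>c\<in>set C. k \<le> fst c" using C by (auto simp: realizes_def)
    have "realizes n u k p (rk n u) ((k, j) # C)"
      unfolding realizes_def
    proof (intro conjI ballI)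
      show "climbs n u ((k, j) # C)" using C' j cov less.prems(3) by (auto simp: v_def)
      fix a assume a: "a \<in> {k..n}"
      then have Ca: "level_marks a (k, j) C \<le> rk n v a" "rk n v a \<le> level_links a C"
        using C by (auto simp: realizes_def)
      show "level_marks a p ((k, j) # C) \<le> rk n u a"
        using Ca le_r 3 tail[of a] a by (cases "a = k") (auto simp: level_marks_Cons)
      show "rk n u a \<le> level_links a ((k, j) # C)"
        using Ca self 3 tail[of a] a by (cases "a = k") (auto simp: level_links_Cons)
    qed (use C' in auto)
    moreover have "level_marks k p ((k, j) # C) \<le> b"
      if b: "Suc b = rk n u k" "fst p = k" "\<forall>m. snd p < m \<and> m \<le> n \<and> u k < u m \<longrightarrow> rk n u m \<noteq> b" for b
    proof -
      have "b = r" using b 3 by simp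
      then have "\<not> is_marked p (k, j)" using b(2,3) j by (auto simp: is_marked_def)
      then show ?thesis using le_r \<open>b = r\<close> by (simp add: level_marks_Cons)
    qed
    ultimately show ?thesis by blast
  qed
qed

text \<open>While \<open>f k\<close> exceeds the rank or equals a positive \<open>asc\<close>,
  swapping with the next larger value uses one unit of \<open>f k\<close> and keeps all data right
  of \<open>k\<close>. Otherwise \<open>f k\<close> is below \<open>asc\<close>, so the staircase
  hypothesis forces \<open>f\<close> to be \<open>rk\<close> from \<open>k\<close> on, which
  \<open>level_chain_exists\<close> handles.\<close>

lemma chain_exists:
  assumes "u permutes {1..n}" "settled n u k" "1 \<le> k" "k \<le> Suc n" "fst p \<le> k"
    and "\<And>a. k \<le> a \<Longrightarrow> a \<le> n \<Longrightarrow> rk n u a \<le> f a \<and> f a \<le> asc n u a"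
    and "\<And>a b. k \<le> b \<Longrightarrow> b < a \<Longrightarrow> a \<le> n \<Longrightarrow> rk n u a < f a \<Longrightarrow> f b = asc n u b"
  shows "\<exists>C. realizes n u k p f C"
  using assms
proof (induction "card (ascents n u) + (Suc n - k)" arbitrary: u k p f rule: less_induct)
  case less
  have inj: "inj u" using less.prems(1) by (rule permutes_inj)
  have f: "rk n u a \<le> f a" "f a \<le> asc n u a" if "k \<le> a" "a \<le> n" for a
    using less.prems(6) that by auto
  consider "k = Suc n" | "k \<le> n" "asc n u k = 0" | "k \<le> n" "asc n u k > 0" "rk n u k < f k \<or> f k = asc n u k"
    | "k \<le> n" "f k = rk n u k" "f k \<noteq> asc n u k"
    using less.prems(4) f(1)[of k] by fastforce
  then show ?case
  proof cases
    case 1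
    then have "u = longest_perm n" using settled_all less.prems by simp
    then show ?thesis using 1 by (intro exI[of _ "[]"]) (simp add: realizes_def level_marks_def)
  next
    case 2
    then have "\<not> u k < u b" if "k < b" "b \<le> n" for b
      using that by (auto simp: asc_def)
    then have "settled n u (Suc k)" using less.prems 2 by (intro settled_Suc) auto
    then obtain C where "realizes n u (Suc k) p f C"
      using less.hyps[of u "Suc k" p f] less.prems 2 by fastforce
    moreover have "f k = 0" using f(2)[of k] 2 by simp
    ultimately show ?thesis using realizes_Suc by blast
  next
    case 3
    txt \<open>Swapping with the next larger value keeps the relative order of the positions after \<open>k\<close>.\<close>
    have "{b \<in> {k<..n}. u k < u b} \<noteq> {}" using 3(2) unfolding asc_def by (metis card.empty less_irrefl)
    then obtain b where "k < b \<and> b \<le> n \<and> u k < u b" by auto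
    then obtain j where "k < j \<and> j \<le> n \<and> u k < u j"
      and none: "\<And>m. k < m \<and> m \<le> n \<and> u k < u m \<Longrightarrow> u j \<le> u m"
      using ex_has_least_nat[of "\<lambda>m. k < m \<and> m \<le> n \<and> u k < u m" b u] by auto
    then have j: "k < j" "j \<le> n" "u k < u j" by auto
    have good: "j < m \<and> rk n u m < rk n u j" if "k < m" "m \<le> n" "u k < u m" "u m < u j" for m
      using none[of m] that by simp
    define v where "v = swp u k j"
    have cov: "cov u k j" using cov_if_no_larger_rk[OF inj j good] .
    have tail: "rk n v a = rk n u a" if "k < a" "a \<le> n" for a
      unfolding v_def using rk_swp_eq[OF inj less.prems(3) j good that] .
    have self: "rk n v k \<le> rk n u k"
      using rk_swp_self(1)[OF less.prems(3) j] tail unfolding v_def by auto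
    have asc_tail: "asc n v a = asc n u a" if "k < a" "a \<le> n" for a
      unfolding v_def using that none by (intro asc_swp_eq(1)[OF inj j]) auto
    have asc_self: "asc n u k = Suc (asc n v k)"
      unfolding v_def using none by (intro asc_swp_eq(2)[OF inj j]) auto
    have perm: "v permutes {1..n}"
      unfolding v_def using less.prems j by (intro permutes_comp_transpose) auto
    have smaller: "card (ascents n u) = Suc (card (ascents n v))"
      unfolding v_def using less.prems j cov inj by (intro card_ascents_cov) auto
    define g where "g = f(k := f k - 1)"
    have fk: "f k = Suc (g k)" using 3 by (auto simp: g_def)
    have gf: "g a = f a" if "a \<noteq> k" for a using that by (simp add: g_def)
    \<comment> \<open>The rank of \<open>k\<close> need not drop with \<open>f k\<close>: either
      there was slack, or \<open>g k\<close> equals the new \<open>asc\<close>, which bounds the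
      rank anyway.\<close>
    have gk: "rk n v k \<le> g k" "g k \<le> asc n v k"
      using 3(3) self fk f(2)[of k] asc_self 3(1) rk_le_asc[OF less.prems(3) 3(1), of v] by auto
    have "rk n v a \<le> g a \<and> g a \<le> asc n v a" if "k \<le> a" "a \<le> n" for a
      using that gk f[of a] gf[of a] tail[of a] asc_tail[of a] by (cases "a = k") auto
    moreover have "g b = asc n v b" if "k \<le> b" "b < a" "a \<le> n" "rk n v a < g a" for a b
    proof -
      have "f b = asc n u b" using less.prems(7)[of b a] that gf[of a] tail[of a] by simp
      then show ?thesis using fk gf[of b] asc_self asc_tail[of b] that by (cases "b = k") auto
    qed
    ultimately obtain C where C: "realizes n v k (k, j) g C"
      using less.hyps[of v k "(k, j)" g] smaller perm settled_swp[OF less.prems(2) j(1)] less.prems(3,4)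
      by (auto simp: v_def)
    have C': "climbs n v C" "\<forall>c\<in>set C. k \<le> fst c" using C by (auto simp: realizes_def)
    have "realizes n u k p f ((k, j) # C)"
      unfolding realizes_def
    proof (intro conjI ballI)
      show "climbs n u ((k, j) # C)" using C' j cov less.prems(3) by (auto simp: v_def)
      fix a assume a: "a \<in> {k..n}"
      then have Ca: "level_marks a (k, j) C \<le> g a" "g a \<le> level_links a C"
        using C by (auto simp: realizes_def)
      show "level_marks a p ((k, j) # C) \<le> f a"
        using Ca fk gf[of a] by (cases "a = k") (auto simp: level_marks_Cons)
      show "f a \<le> level_links a ((k, j) # C)"
        using Ca fk gf[of a] by (cases "a = k") (auto simp: level_links_Cons)
    qed (use C' in auto)
    then show ?thesis by blast
  next
    case 4
    have "f a = rk n u a" if "a \<in> {k..n}" for a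
      using less.prems(7)[of k a] f(1)[of a] 4 that by (cases "a = k") force+
    moreover obtain C where "realizes n u k p (rk n u) C"
      using level_chain_exists[OF less.prems(1-5)] by blast
    ultimately have "realizes n u k p f C" by (simp add: realizes_def)
    then show ?thesis by blast
  qed
qed

lemma climbs_bounds: "climbs n u C \<Longrightarrow> (i, j) \<in> set C \<Longrightarrow> 1 \<le> i \<and> i < j \<and> j \<le> n"
  by (induction n u C rule: climbs.induct) auto

lemma sum_card_fibres:
  fixes n k :: nat and U :: "(nat \<times> 'a) set"
  assumes "finite U" "\<And>c. c \<in> U \<Longrightarrow> fst c \<le> n"
  shows "card {c \<in> U. k \<le> fst c} = (\<Sum>a\<in>{k..n}. card {c \<in> U. fst c = a})"
proof -
  have eq: "{c \<in> U. k \<le> fst c} = (\<Union>a\<in>{k..n}. {c \<in> U. fst c = a})" using assms(2) by auto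
  show ?thesis unfolding eq by (rule card_UN_disjoint) (use assms(1) in auto)
qed

lemma card_filter_distinct: "distinct C \<Longrightarrow> card {c \<in> set C. P c} = length (filter P C)"
  by (metis distinct_card distinct_filter set_filter)

lemma marked_chain_if_realizes:
  assumes "w permutes {1..n}" "realizes n w 1 (0, 0) f C"
  shows "\<exists>U. marked_climbing_chain n w C U \<and> card U = (\<Sum>a\<in>{1..n}. f a) \<and>
    (\<forall>a\<in>{1..n}. card {c \<in> U. fst c = a} = f a)"
proof -
  have C: "climbs n w C" "\<forall>c\<in>set C. 1 \<le> fst c" using assms(2) by (auto simp: realizes_def)
  have dist: "distinct C" using C(1) by (rule climbs_distinct)
  define M where "M = set (marks (0, 0) C)"
  have M: "M \<subseteq> set C" unfolding M_def by (rule set_marks_subset)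
  have "\<exists>V. {c \<in> M. fst c = a} \<subseteq> V \<and> V \<subseteq> {c \<in> set C. fst c = a} \<and> card V = f a"
    if "a \<in> {1..n}" for a
  proof -
    have "card {c \<in> M. fst c = a} \<le> f a" "f a \<le> card {c \<in> set C. fst c = a}"
      using assms(2) that distinct_marks[OF dist] dist unfolding M_def
      by (auto simp: realizes_def level_marks_def level_links_def card_filter_distinct)
    then show ?thesis using M by (intro exists_subset_between) auto
  qed
  then have "\<exists>V. \<forall>a\<in>{1..n}.
      {c \<in> M. fst c = a} \<subseteq> V a \<and> V a \<subseteq> {c \<in> set C. fst c = a} \<and> card (V a) = f a"
    by (intro bchoice) blast
  then obtain V where V: "\<And>a. a \<in> {1..n} \<Longrightarrow>
      {c \<in> M. fst c = a} \<subseteq> V a \<and> V a \<subseteq> {c \<in> set C. fst c = a} \<and> card (V a) = f a"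
    by blast
  define U where "U = (\<Union>a\<in>{1..n}. V a)"
  have bd: "1 \<le> fst c \<and> fst c \<le> n" if "c \<in> set C" for c
    using climbs_bounds[OF C(1), of "fst c" "snd c"] that by simp
  have sub: "U \<subseteq> set C" using V by (fastforce simp: U_def)
  have "M \<subseteq> U"
  proof
    fix c assume "c \<in> M"
    then have "fst c \<in> {1..n}" "c \<in> {d \<in> M. fst d = fst c}" using M bd[of c] by auto
    then show "c \<in> U" using V unfolding U_def by blast
  qed
  then have "marked_climbing_chain n w C U"
    using sub C climbing_chain_iff_climbs[OF assms(1)] min_markings_eq[OF C(2)]
    by (simp add: marked_climbing_chain_def M_def)
  moreover have fib: "card {c \<in> U. fst c = a} = f a" if "a \<in> {1..n}" for a
  proof -
    have "{c \<in> U. fst c = a} = V a" using V that unfolding U_def by blast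
    then show ?thesis using V that by simp
  qed
  moreover have "card U = (\<Sum>a\<in>{1..n}. f a)"
  proof -
    have "{c \<in> U. 1 \<le> fst c} = U" using sub bd by auto
    then show ?thesis
      using sum_card_fibres[of U n 1] finite_subset[OF sub] sub bd fib by auto
  qed
  ultimately show ?thesis by blast
qed

text \<open>If \<open>f\<close> is \<open>rk\<close> from \<open>k\<close> on, minimal markings
  suffice. Otherwise \<open>f\<close> is \<open>asc\<close> before \<open>k\<close>; the total
  number of links being fixed, \<open>tail_asc_le_links\<close> caps the links before
  \<open>k\<close> by that head sum, and the size of \<open>U\<close> leaves the rest to the
  tail.\<close>

lemma tail_le_marking:
  assumes "w permutes {1..n}" "marked_climbing_chain n w C U"
    and Q: "\<And>a b. 1 \<le> b \<Longrightarrow> b < a \<Longrightarrow> a \<le> n \<Longrightarrow> f a \<noteq> rk n w a \<Longrightarrow> f b = asc n w b"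
    and total: "card U = (\<Sum>a\<in>{1..n}. f a)"
    and k: "1 \<le> k" "k \<le> n"
  shows "(\<Sum>a\<in>{k..n}. f a) \<le> (\<Sum>a\<in>{k..n}. card {c \<in> U. fst c = a})"
proof -
  have C: "climbs n w C" and U: "min_markings C \<subseteq> U" "U \<subseteq> set C"
    using assms(2) climbing_chain_iff_climbs[OF assms(1)] by (auto simp: marked_climbing_chain_def)
  have bd: "1 \<le> fst c \<and> fst c \<le> n" if "c \<in> set C" for c
    using climbs_bounds[OF C, of "fst c" "snd c"] that by simp
  have fin: "finite U" using U(2) by (rule finite_subset) simp
  have dist: "distinct C" using C by (rule climbs_distinct)
  have tail: "(\<Sum>a\<in>{k..n}. card {c \<in> U. fst c = a}) = card {c \<in> U. k \<le> fst c}"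
    using bd U(2) by (intro sum_card_fibres[OF fin, symmetric]) blast
  show ?thesis
  proof (cases "\<forall>a\<in>{k..n}. f a = rk n w a")
    case True
    then have "(\<Sum>a\<in>{k..n}. f a) = (\<Sum>a\<in>{k..n}. rk n w a)" by simp
    also have "\<dots> \<le> length (filter (\<lambda>c. k \<le> fst c) (marks (0, 0) C))"
      using tail_rk_le_marks[OF C k(1), of "(0, 0)"] k by simp
    also have "\<dots> = card {c \<in> min_markings C. k \<le> fst c}"
      using min_markings_eq[of C] bd distinct_marks[OF dist] by (simp add: card_filter_distinct)
    also have "\<dots> \<le> card {c \<in> U. k \<le> fst c}" using U fin by (intro card_mono) auto
    finally show ?thesis using tail by simp
  next
    case False
    then obtain a where "a \<in> {k..n}" "f a \<noteq> rk n w a" by auto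
    then have head: "f b = asc n w b" if "b \<in> {1..<k}" for b using Q[of b a] that by auto
    have split: "(\<Sum>a\<in>{1..n}. g a) = (\<Sum>a\<in>{1..<k}. g a) + (\<Sum>a\<in>{k..n}. g a)" for g :: "nat \<Rightarrow> nat"
      using k by (subst sum.union_disjoint[symmetric]) (auto intro!: sum.cong)
    have "card {c \<in> U. \<not> k \<le> fst c} \<le> card {c \<in> set C. \<not> k \<le> fst c}"
      using U by (intro card_mono) auto
    also have "\<dots> = length (filter (\<lambda>c. \<not> k \<le> fst c) C)"
      using dist by (simp add: card_filter_distinct)
    also have "\<dots> \<le> (\<Sum>a\<in>{1..<k}. asc n w a)"
      using tail_asc_le_links[OF C assms(1) k(1)] climbs_length[OF C assms(1)]
        sum_length_filter_compl[of "\<lambda>c. k \<le> fst c" C] split[of "asc n w"]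
      by (simp add: card_ascents)
    also have "\<dots> = (\<Sum>a\<in>{1..<k}. f a)" using head by simp
    finally have "card {c \<in> U. \<not> k \<le> fst c} \<le> (\<Sum>a\<in>{1..<k}. f a)" .
    moreover have "card U = card {c \<in> U. k \<le> fst c} + card {c \<in> U. \<not> k \<le> fst c}"
      using fin by (subst card_Un_disjoint[symmetric]) (auto intro!: arg_cong[where f = card])
    ultimately show ?thesis using tail total split[of f] by simp
  qed
qed

section \<open>The vectors \<open>L\<^sub>w\<close>\<close>

lemma invcode_eq:
  assumes "w permutes {1..n}" "1 \<le> a" "a \<le> n"
  shows "invcode n w a = int n - int a - int (asc n w a)"
proof -
  have "{a<..n} = {b \<in> {a<..n}. w a < w b} \<union> {b \<in> {1..n}. a < b \<and> w b < w a}"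
  proof -
    have "w b < w a \<or> w a < w b" if "a < b" for b
      using permutes_inj[OF assms(1)] that by (metis injD less_irrefl linorder_neqE_nat)
    then show ?thesis using assms(2) by fastforce
  qed
  moreover have "card ({b \<in> {a<..n}. w a < w b} \<union> {b \<in> {1..n}. a < b \<and> w b < w a}) =
      asc n w a + card {b \<in> {1..n}. a < b \<and> w b < w a}"
    unfolding asc_def by (rule card_Un_disjoint) auto
  ultimately have "n - a = asc n w a + card {b \<in> {1..n}. a < b \<and> w b < w a}"
    by (metis card_greaterThanAtMost)
  then show ?thesis using assms(3) by (simp add: invcode_def)
qed

lemma rajcode_eq:
  assumes "1 \<le> a" "a \<le> n"
  shows "rajcode n w a = int n - int a - int (rk n w a)"
  using dual_rajcode_eq_rk[OF assms] by (simp add: rajcode_def)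

text \<open>Each increment hits the last unsaturated index, so everything right of it is saturated
  and no index left of an unsaturated one has been touched. The size invariant keeps the set under
  \<open>Max\<close> nonempty.\<close>

lemma Lvec_between:
  assumes "w permutes {1..n}" "int d \<le> raj n w - inv_stat n w"
  shows "(\<forall>a\<in>{1..n}. invcode n w a \<le> Lvec n w d a \<and> Lvec n w d a \<le> rajcode n w a) \<and>
    (\<forall>a b. 1 \<le> b \<and> b < a \<and> a \<le> n \<and> Lvec n w d a < rajcode n w a \<longrightarrow> Lvec n w d b = invcode n w b) \<and>
    vec_size n (Lvec n w d) = inv_stat n w + int d"
  using assms(2)
proof (induction d)
  case 0
  have "invcode n w a \<le> rajcode n w a" if "a \<in> {1..n}" for a
    using that rk_le_asc[of a n w] invcode_eq[OF assms(1), of a] rajcode_eq[of a n w] by simp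
  then show ?case by (simp add: inv_stat_def)
next
  case (Suc d)
  define L where "L = Lvec n w d"
  have bet: "invcode n w a \<le> L a" "L a \<le> rajcode n w a" if "a \<in> {1..n}" for a
    using Suc that by (auto simp: L_def)
  have stair: "L b = invcode n w b" if "1 \<le> b" "b < a" "a \<le> n" "L a < rajcode n w a" for a b
    using Suc that by (auto simp: L_def)
  have size: "vec_size n L = inv_stat n w + int d" using Suc by (auto simp: L_def)
  define j where "j = Max {k \<in> {1..n}. L k < rajcode n w k}"
  have "\<exists>k\<in>{1..n}. L k < rajcode n w k"
  proof (rule ccontr)
    assume "\<not> ?thesis"
    then have "(\<Sum>k\<in>{1..n}. rajcode n w k) \<le> (\<Sum>k\<in>{1..n}. L k)"
      by (intro sum_mono) (simp add: not_less)
    then show False using size Suc.prems by (simp add: vec_size_def raj_def)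
  qed
  then have "j \<in> {k \<in> {1..n}. L k < rajcode n w k}" unfolding j_def by (intro Max_in) auto
  then have j: "j \<in> {1..n}" "L j < rajcode n w j" by auto
  have jmax: "a \<le> j" if "a \<in> {1..n}" "L a < rajcode n w a" for a
    unfolding j_def using that by (intro Max_ge) auto
  have L': "Lvec n w (Suc d) = L(j := L j + 1)" by (simp add: L_def j_def Let_def)
  have "vec_size n (L(j := L j + 1)) = vec_size n L + 1"
    using j(1) by (simp add: vec_size_def sum.remove[of _ j])
  moreover have "(L(j := L j + 1)) b = invcode n w b"
    if "1 \<le> b" "b < a" "a \<le> n" "(L(j := L j + 1)) a < rajcode n w a" for a b
  proof -
    have "L a < rajcode n w a" using that(4) by (auto split: if_splits)
    then show ?thesis using that jmax[of a] stair[of b a] by auto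
  qed
  moreover have "invcode n w a \<le> (L(j := L j + 1)) a \<and> (L(j := L j + 1)) a \<le> rajcode n w a"
    if "a \<in> {1..n}" for a using bet[OF that] j by auto
  ultimately show ?case unfolding L' using size by (auto simp del: fun_upd_apply)
qed

section \<open>Term orders and tail sums\<close>

lemma lookup_xpow: "Poly_Mapping.lookup (xpow n v) k = (if k \<in> {1..n} then v k else 0)"
  by (simp add: xpow_def lookup_sum lookup_single when_def)

lemma xpow_cong: "(\<And>k. k \<in> {1..n} \<Longrightarrow> f k = g k) \<Longrightarrow> xpow n f = xpow n g"
  by (simp add: xpow_def)

lemma xpow_in_monomials: "(\<And>k. k \<in> {1..n} \<Longrightarrow> 0 \<le> f k) \<Longrightarrow> xpow n f \<in> monomials n"
  by (auto simp: monomials_def lookup_xpow in_keys_iff split: if_splits)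

lemma xpow_add: "xpow n (\<lambda>k. f k + g k) = xpow n f + xpow n g"
  by (rule poly_mapping_eqI) (simp add: lookup_xpow lookup_add)

lemma monomials_add: "a \<in> monomials n \<Longrightarrow> b \<in> monomials n \<Longrightarrow> a + b \<in> monomials n"
  using keys_add[of a b] by (auto simp: monomials_def lookup_add)

lemma single_in_monomials: "k \<in> {1..n} \<Longrightarrow> 0 \<le> m \<Longrightarrow> Poly_Mapping.single k m \<in> monomials n"
  by (auto simp: monomials_def lookup_single when_def)

locale increasing_term_order =
  fixes n :: nat and r :: "(nat \<Rightarrow>\<^sub>0 int) rel"
  assumes order: "term_order n r" and vars: "vars_increasing n r"
begin

lemma term_refl: "a \<in> monomials n \<Longrightarrow> (a, a) \<in> r"
  using order
  by (auto simp: term_order_def linear_order_on_def partial_order_on_def preorder_on_def refl_on_def)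

lemma term_trans: "(a, b) \<in> r \<Longrightarrow> (b, c) \<in> r \<Longrightarrow> (a, c) \<in> r"
  using order
  by (auto simp: term_order_def linear_order_on_def partial_order_on_def preorder_on_def dest: transD)

lemma add_mono_right:
  "\<lbrakk>a \<in> monomials n; b \<in> monomials n; c \<in> monomials n; (a, b) \<in> r\<rbrakk> \<Longrightarrow> (a + c, b + c) \<in> r"
  using order by (auto simp: term_order_def)

lemma add_mono:
  assumes "a \<in> monomials n" "b \<in> monomials n" "(a, b) \<in> r"
    and "c \<in> monomials n" "d \<in> monomials n" "(c, d) \<in> r"
  shows "(a + c, b + d) \<in> r"
  using term_trans[OF add_mono_right[of a b c] add_mono_right[of c d b, unfolded add.commute[of _ b]]] assms
  by blast

text \<open>Totality and antisymmetry turn compatibility with products into cancellation.\<close>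

lemma add_cancel:
  assumes "a \<in> monomials n" "b \<in> monomials n" "c \<in> monomials n" "(a + c, b + c) \<in> r"
  shows "(a, b) \<in> r"
proof (rule ccontr)
  assume ab: "(a, b) \<notin> r"
  then have "a \<noteq> b" using term_refl assms(1) by auto
  then have "(b, a) \<in> r"
    using order assms(1,2) ab by (auto simp: term_order_def linear_order_on_def total_on_def)
  then have "(b + c, a + c) \<in> r" using assms by (intro add_mono_right) auto
  moreover have "antisym r"
    using order by (simp add: term_order_def linear_order_on_def partial_order_on_def)
  ultimately have "a + c = b + c" using assms(4) by (meson antisymD)
  then show False using \<open>a \<noteq> b\<close> by simp
qed

lemma single_mono:
  assumes "i \<in> {1..n}" "j \<in> {1..n}" "i < j"
  shows "(Poly_Mapping.single i (int m), Poly_Mapping.single j (int m)) \<in> r"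
proof (induction m)
  case 0
  have "(0 :: nat \<Rightarrow>\<^sub>0 int) \<in> monomials n" by (simp add: monomials_def)
  then show ?case using term_refl by simp
next
  case (Suc m)
  have "(Poly_Mapping.single i 1 + Poly_Mapping.single i (int m),
      Poly_Mapping.single j 1 + Poly_Mapping.single j (int m)) \<in> r"
    using assms Suc vars by (intro add_mono single_in_monomials) (auto simp: vars_increasing_def)
  then show ?case by (simp flip: single_add)
qed

lemma sum_le:
  assumes "finite K" "\<And>k. k \<in> K \<Longrightarrow> a k \<in> monomials n \<and> b k \<in> monomials n \<and> (a k, b k) \<in> r"
  shows "(sum a K, sum b K) \<in> r \<and> sum a K \<in> monomials n \<and> sum b K \<in> monomials n"
  using assms
proof (induction K rule: finite_induct)
  case empty
  have "(0 :: nat \<Rightarrow>\<^sub>0 int) \<in> monomials n" by (simp add: monomials_def)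
  then show ?case using term_refl by simp
next
  case (insert k K)
  then show ?case by (simp add: add_mono monomials_add)
qed

text \<open>Each power of a variable is traded for the same power of the preceding one; the two zero
  boundary values make the factors match up.\<close>

lemma xpow_shift_le:
  assumes "\<And>k. k \<in> {1..Suc n} \<Longrightarrow> 0 \<le> d k" "d 1 = 0" "d (Suc n) = 0"
  shows "(xpow n (\<lambda>k. d (Suc k)), xpow n d) \<in> r"
proof -
  have "xpow n (\<lambda>k. d (Suc k)) = (\<Sum>k\<in>{1..<n}. Poly_Mapping.single k (d (Suc k)))"
    unfolding xpow_def using assms(3) by (intro sum.mono_neutral_right) auto
  moreover have "xpow n d = (\<Sum>k\<in>{Suc 1..<Suc n}. Poly_Mapping.single k (d k))"
    unfolding xpow_def using assms(2)
  proof (intro sum.mono_neutral_right ballI)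
    fix k assume "k \<in> {1..n} - {Suc 1..<Suc n}"
    then have "k = 1" by auto
    then show "Poly_Mapping.single k (d k) = 0" using assms(2) by simp
  qed auto
  moreover have "(\<Sum>k\<in>{Suc 1..<Suc n}. Poly_Mapping.single k (d k)) =
      (\<Sum>k\<in>{1..<n}. Poly_Mapping.single (Suc k) (d (Suc k)))"
    by (rule sum.shift_bounds_Suc_ivl)
  moreover have "(Poly_Mapping.single k (d (Suc k)), Poly_Mapping.single (Suc k) (d (Suc k))) \<in> r"
    if "k \<in> {1..<n}" for k
    using single_mono[of k "Suc k" "nat (d (Suc k))"] assms(1)[of "Suc k"] that by simp
  ultimately show ?thesis
    using assms(1)
    by (auto intro!: conjunct1[OF sum_le] single_in_monomials)
qed

text \<open>With \<open>d k\<close> the difference of the tail sums from \<open>k\<close> on, \<open>g - f = \<Sum>\<^sub>k d k (e\<^sub>k - e\<^sub>k\<^sub>-\<^sub>1)\<close>, so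
  \<open>g\<close> arises from \<open>f\<close> by moving exponents to larger variables. The intermediate vectors may have
  negative entries; hence the comparison after multiplication by a monomial.\<close>

lemma xpow_le_if_tails_le:
  assumes "\<And>k. k \<in> {1..n} \<Longrightarrow> 0 \<le> f k" "\<And>k. k \<in> {1..n} \<Longrightarrow> 0 \<le> g k"
    and "(\<Sum>a\<in>{1..n}. f a) = (\<Sum>a\<in>{1..n}. g a)"
    and "\<And>k. k \<in> {1..n} \<Longrightarrow> (\<Sum>a\<in>{k..n}. f a) \<le> (\<Sum>a\<in>{k..n}. g a)"
  shows "(xpow n f, xpow n g) \<in> r"
proof -
  define d where "d k = (\<Sum>a\<in>{k..n}. g a) - (\<Sum>a\<in>{k..n}. f a)" for k
  have d0: "d 1 = 0" "d (Suc n) = 0" using assms(3) by (auto simp: d_def)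
  have d_ge: "0 \<le> d k" if "k \<in> {1..Suc n}" for k
    using assms(4)[of k] that d0(2) by (cases "k = Suc n") (auto simp: d_def)
  have eq: "g k + d (Suc k) = f k + d k" if "k \<in> {1..n}" for k
    using that by (simp add: d_def sum.atLeast_Suc_atMost)
  have m: "xpow n f \<in> monomials n" "xpow n g \<in> monomials n" "xpow n d \<in> monomials n"
      "xpow n (\<lambda>k. d (Suc k)) \<in> monomials n"
    using assms(1,2) d_ge by (auto intro!: xpow_in_monomials)
  have "(xpow n (\<lambda>k. d (Suc k)) + xpow n f, xpow n d + xpow n f) \<in> r"
    using m d_ge d0 by (intro add_mono_right xpow_shift_le) auto
  moreover have "xpow n d + xpow n f = xpow n g + xpow n (\<lambda>k. d (Suc k))"
    unfolding xpow_add[symmetric] by (rule xpow_cong) (simp add: eq)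
  ultimately have "(xpow n f + xpow n (\<lambda>k. d (Suc k)), xpow n g + xpow n (\<lambda>k. d (Suc k))) \<in> r"
    by (simp add: add.commute)
  then show ?thesis using m add_cancel by blast
qed

end

theorem theorem10p3:
  fixes n d :: nat and w :: "nat \<Rightarrow> nat" and r :: "(nat \<Rightarrow>\<^sub>0 int) rel"
  assumes "w permutes {1..n}"
    and "term_order n r"
    and "vars_increasing n r"
    and "1 \<le> d"
    and "int d \<le> raj n w - inv_stat n w"
  shows "is_minimum r
           {xpow n (dual_wt U) | C U. marked_climbing_chain n w C U \<and>
              int (card U) = int (length C) - int d}
           (xpow n (dual_Lvec n w d)) \<and>
         is_maximum r
           {xpow n (wt n U) | C U. marked_climbing_chain n w C U \<and>
              int (card U) = int (length C) - int d}
           (xpow n (Lvec n w d))"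
proof -
  interpret increasing_term_order n r using assms(2,3) by unfold_locales
  define f where "f a = nat (dual_Lvec n w d a)" for a
  have L: "invcode n w a \<le> Lvec n w d a" "Lvec n w d a \<le> rajcode n w a" if "a \<in> {1..n}" for a
    using Lvec_between[OF assms(1,5)] that by auto
  have stair: "Lvec n w d b = invcode n w b"
    if "1 \<le> b" "b < a" "a \<le> n" "Lvec n w d a < rajcode n w a" for a b
    using Lvec_between[OF assms(1,5)] that by blast
  have size: "vec_size n (Lvec n w d) = inv_stat n w + int d"
    using Lvec_between[OF assms(1,5)] by blast
  have fL: "int (f a) = dual_Lvec n w d a" and f: "rk n w a \<le> f a" "f a \<le> asc n w a"
    if "a \<in> {1..n}" for a
    using L[OF that] that invcode_eq[OF assms(1), of a] rajcode_eq[of a n w]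
    by (simp_all add: f_def dual_Lvec_def)
  have Q: "f b = asc n w b" if "1 \<le> b" "b < a" "a \<le> n" "f a \<noteq> rk n w a" for a b
  proof -
    have "Lvec n w d a < rajcode n w a"
      using L(2)[of a] that fL[of a] rajcode_eq[of a n w] by (simp add: dual_Lvec_def)
    then have "Lvec n w d b = invcode n w b" using stair that by blast
    then show ?thesis using fL[of b] that invcode_eq[OF assms(1), of b] by (simp add: dual_Lvec_def)
  qed
  have total: "int (\<Sum>a\<in>{1..n}. f a) = int (card (ascents n w)) - int d"
  proof -
    have "int (\<Sum>a\<in>{1..n}. f a) = (\<Sum>a\<in>{1..n}. int n - int a) - vec_size n (Lvec n w d)"
      using fL by (simp add: dual_Lvec_def vec_size_def sum_subtractf)
    moreover have "inv_stat n w = (\<Sum>a\<in>{1..n}. int n - int a) - int (card (ascents n w))"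
      using invcode_eq[OF assms(1)] by (simp add: inv_stat_def vec_size_def card_ascents sum_subtractf)
    ultimately show ?thesis using size by simp
  qed
  have len: "length C = card (ascents n w)" if "marked_climbing_chain n w C U" for C U
    using that climbs_length[OF _ assms(1)] climbing_chain_iff_climbs[OF assms(1)]
    by (auto simp: marked_climbing_chain_def)
  have "settled n w 1" by (auto simp: settled_def)
  then obtain C where "realizes n w 1 (0, 0) f C"
    using chain_exists[OF assms(1), of 1 "(0, 0)" f] f Q by (auto simp: less_imp_neq[THEN not_sym])
  then obtain U where U: "marked_climbing_chain n w C U" "card U = (\<Sum>a\<in>{1..n}. f a)"
      "\<forall>a\<in>{1..n}. card {c \<in> U. fst c = a} = f a"
    using marked_chain_if_realizes[OF assms(1)] by blast
  have dual: "dual_wt U a = dual_Lvec n w d a" if "a \<in> {1..n}" for a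
    using U(3) that fL[OF that] by (simp add: dual_wt_def)
  have mem_min: "xpow n (dual_Lvec n w d) = xpow n (dual_wt U)"
    using dual by (intro xpow_cong) simp
  have mem_max: "xpow n (Lvec n w d) = xpow n (wt n U)"
    using dual by (intro xpow_cong) (simp add: wt_def dual_Lvec_def)
  have card_U: "int (card U) = int (length C) - int d" using U(1,2) total len by simp
  have cmp: "(xpow n (dual_Lvec n w d), xpow n (dual_wt V)) \<in> r \<and>
      (xpow n (wt n V), xpow n (Lvec n w d)) \<in> r"
    if V: "marked_climbing_chain n w D V" "int (card V) = int (length D) - int d" for D V
  proof -
    have D: "climbs n w D" and VD: "V \<subseteq> set D"
      using V(1) climbing_chain_iff_climbs[OF assms(1)] by (auto simp: marked_climbing_chain_def)
    have bd: "1 \<le> fst c \<and> fst c < snd c \<and> snd c \<le> n" if "c \<in> V" for c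
      using climbs_bounds[OF D, of "fst c" "snd c"] VD that by auto
    have card_V: "card V = (\<Sum>a\<in>{1..n}. f a)" using V(2) len[OF V(1)] total by linarith
    have dual_sum: "(\<Sum>a\<in>{k..n}. dual_Lvec n w d a) = int (\<Sum>a\<in>{k..n}. f a)" if "1 \<le> k" for k
      unfolding of_nat_sum using that by (intro sum.cong fL[symmetric]) auto
    have wt_sum: "(\<Sum>a\<in>{k..n}. dual_wt V a) = int (\<Sum>a\<in>{k..n}. card {c \<in> V. fst c = a})" for k
      by (simp add: dual_wt_def)
    have tails: "(\<Sum>a\<in>{k..n}. dual_Lvec n w d a) \<le> (\<Sum>a\<in>{k..n}. dual_wt V a)" if "k \<in> {1..n}" for k
    proof -
      have "(\<Sum>a\<in>{k..n}. f a) \<le> (\<Sum>a\<in>{k..n}. card {c \<in> V. fst c = a})"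
        using that Q by (intro tail_le_marking[OF assms(1) V(1) _ card_V]) auto
      then show ?thesis using dual_sum[of k] wt_sum[of k] that by (simp del: of_nat_sum)
    qed
    have sum_eq: "(\<Sum>a\<in>{1..n}. dual_Lvec n w d a) = (\<Sum>a\<in>{1..n}. dual_wt V a)"
    proof -
      have "finite V" using VD by (rule finite_subset) simp
      moreover have "{c \<in> V. 1 \<le> fst c} = V" using bd by blast
      moreover have "fst c \<le> n" if "c \<in> V" for c using bd[OF that] by simp
      ultimately have "card V = (\<Sum>a\<in>{1..n}. card {c \<in> V. fst c = a})"
        using sum_card_fibres[of V n 1] by simp
      then show ?thesis using dual_sum[of 1] wt_sum[of 1] card_V by (simp del: of_nat_sum)
    qed
    \<comment> \<open>Term orders compare genuine monomials only; level \<open>a\<close> has at most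
      n - a possible partners, so the weight is nonnegative.\<close>
    have wt_ge: "0 \<le> wt n V a" if "a \<in> {1..n}" for a
    proof -
      have "c \<in> {a} \<times> {a<..n}" if "c \<in> {c \<in> V. fst c = a}" for c
        using bd[of c] that by (cases c) auto
      then have "{c \<in> V. fst c = a} \<subseteq> {a} \<times> {a<..n}" by blast
      then have "card {c \<in> V. fst c = a} \<le> card ({a} \<times> {a<..n})" by (intro card_mono) auto
      then have "card {c \<in> V. fst c = a} \<le> n - a" by (simp add: card_cartesian_product)
      moreover have "a \<le> n" using that by simp
      ultimately show ?thesis unfolding wt_def dual_wt_def by linarith
    qed
    have "(xpow n (dual_Lvec n w d), xpow n (dual_wt V)) \<in> r"
    proof (rule xpow_le_if_tails_le)
      show "0 \<le> dual_Lvec n w d a" if "a \<in> {1..n}" for a by (simp flip: fL[OF that])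
      show "0 \<le> dual_wt V a" for a by (simp add: dual_wt_def)
    qed (fact sum_eq, fact tails)
    moreover have "(xpow n (wt n V), xpow n (Lvec n w d)) \<in> r"
    proof (rule xpow_le_if_tails_le)
      \<comment> \<open>Weight and dual weight add up to the vector with entries n - k, as do
        \<open>Lvec\<close> and \<open>dual_Lvec\<close>, so the tail inequalities just
        reverse.\<close>
      have Leq: "Lvec n w d a = (int n - int a) - dual_Lvec n w d a" for a by (simp add: dual_Lvec_def)
      show "0 \<le> Lvec n w d a" if "a \<in> {1..n}" for a
        using L(1)[OF that] by (simp add: invcode_def)
      show "(\<Sum>a\<in>{1..n}. wt n V a) = (\<Sum>a\<in>{1..n}. Lvec n w d a)"
        unfolding wt_def Leq sum_subtractf using sum_eq by simp
      show "(\<Sum>a\<in>{k..n}. wt n V a) \<le> (\<Sum>a\<in>{k..n}. Lvec n w d a)" if "k \<in> {1..n}" for k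
        unfolding wt_def Leq sum_subtractf using tails[OF that] by simp
    qed (use wt_ge in auto)
    ultimately show ?thesis by blast
  qed
  show ?thesis
    unfolding is_minimum_def is_maximum_def
  proof (intro conjI ballI)
    show "xpow n (dual_Lvec n w d) \<in> {xpow n (dual_wt U) | C U. marked_climbing_chain n w C U \<and>
        int (card U) = int (length C) - int d}"
      unfolding mem_min using U(1) card_U by blast
    show "xpow n (Lvec n w d) \<in> {xpow n (wt n U) | C U. marked_climbing_chain n w C U \<and>
        int (card U) = int (length C) - int d}"
      unfolding mem_max using U(1) card_U by blast
  qed (use cmp in blast)+
qed

end
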